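(* Let $q$ be a prime power, $V=\mathbb{F}_q^n$, $0\le d\le n$, and let $f\in L^2(\mathrm{SL}(V))_{=d}$. Then $$\|j(f)^{\le d}\|_2\ge\frac{1}{4q}\|f\|_2.$$
   Context: For a finite set $X$, $L^2(X)$ is the space of functions $X\to\mathbb{C}$ with $\langle f,g\rangle=\mathbb{E}_{x\in X}[f(x)\overline{g(x)}]$ (uniform $x$), $\|f\|_2^2=\langle f,f\rangle$. Level on $\mathrm{SL}(V)$: let $\omega$ be the permutation representation of $\mathrm{SL}(V)$ on $L^2(V)$, $\omega(g)f(x)=f(g^{-1}x)$. An irreducible complex representation of $\mathrm{SL}(V)$ has tensor rank $d$ if it is a subrepresentation of $\omega^{\otimes d}$ but not of $\omega^{\otimes(d-1)}$ ($\omega^{\otimes 0}$ is the trivial representation). $L^2(\mathrm{SL}(V))_{=d}$ is the span of the matrix coefficients $g\mapsto\langle\rho(g)v,u\rangle$ of all irreducible representations $\rho$ of tensor rank $d$. Degree on $\mathcal{L}(V,V)$ (the space of linear maps $V\to V$): write $q=p^m$ with $p$ prime and let $\varphi:\mathbb{F}_q\to\mathbb{C}^\times$, $\varphi(x)=e^{\frac{2\pi i}{p}\sum_{i=0}^{m-1}x^{p^i}}$. For $X\in\mathcal{L}(V,V)$ put $u_X(A)=\varphi(\mathrm{tr}(XA))$; these form an orthonormal basis of $L^2(\mathcal{L}(V,V))$. With $\hat f(X)=\langle f,u_X\rangle$, set $f^{\le d}=\sum_{\mathrm{rank}(X)\le d}\hat f(X)u_X$. $j:L^2(\mathrm{SL}(V))\to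 L^2(\mathcal{L}(V,V))$ is extension by zero: $j(f)(x)=f(x)$ if $x\in\mathrm{SL}(V)$ and $j(f)(x)=0$ otherwise. In the claim, $\|j(f)^{\le d}\|_2$ is the norm of $L^2(\mathcal{L}(V,V))$ and $\|f\|_2$ that of $L^2(\mathrm{SL}(V))$. *)

theory Defs
  imports
    "HOL-Analysis.Analysis"
    "HOL-Library.Function_Algebras"
    "HOL-Computational_Algebra.Primes"
    "Jordan_Normal_Form.Gauss_Jordan_Elimination"
    "Jordan_Normal_Form.DL_Rank"
    "Jordan_Normal_Form.Conjugate"
begin

section \<open>Functions on a finite set\<close>

text \<open>
  A function from a set \<open>X\<close> to the complex numbers is represented by a total function that
  vanishes outside \<open>X\<close>.
\<close>

definition L2 :: "'x set \<Rightarrow> ('x \<Rightarrow> complex) set" where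
  "L2 X = {f. \<forall>x. x \<notin> X \<longrightarrow> f x = 0}"

definition L2_inner :: "'x set \<Rightarrow> ('x \<Rightarrow> complex) \<Rightarrow> ('x \<Rightarrow> complex) \<Rightarrow> complex" where
  "L2_inner X f g = (\<Sum>x\<in>X. f x * cnj (g x)) / of_nat (card X)"

definition L2_norm :: "'x set \<Rightarrow> ('x \<Rightarrow> complex) \<Rightarrow> real" where
  "L2_norm X f = sqrt (Re (L2_inner X f f))"

interpretation cfun: vector_space "\<lambda>(c::complex) (f::'x \<Rightarrow> complex) x. c * f x"
  by unfold_locales (auto simp: fun_eq_iff algebra_simps)


section \<open>The special linear group and its representations\<close>

text \<open>The space \<open>V\<close> is \<^term>\<open>carrier_vec n :: 'a::finite_field vec set\<close>.\<close>

definition SL :: "nat \<Rightarrow> 'a::finite_field mat set" where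
  "SL n = {g \<in> carrier_mat n n. det g = 1}"

definition perm_rep :: "nat \<Rightarrow> 'a::finite_field mat \<Rightarrow> ('a vec \<Rightarrow> complex) \<Rightarrow> 'a vec \<Rightarrow> complex" where
  "perm_rep n g f = (\<lambda>x. if x \<in> carrier_vec n then f (the (mat_inverse g) *\<^sub>v x) else 0)"

text \<open>
  The \<open>d\<close>-th tensor power of an operator \<open>S\<close> on functions on \<open>X\<close>. The \<open>d\<close>-th tensor power of
  the space of functions on \<open>X\<close> is the space of functions on lists of length \<open>d\<close> over \<open>X\<close>, a pure
  tensor \<open>f\<^sub>1 \<otimes> \<dots> \<otimes> f\<^sub>d\<close> being the function that maps \<open>[x\<^sub>1, \<dots>, x\<^sub>d]\<close> to \<open>f\<^sub>1 x\<^sub>1 * \<dots> * f\<^sub>d x\<^sub>d\<close>.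
  In the recursive clause \<open>S\<close> acts on the first coordinate and its tensor power on the others.
\<close>

fun tensor_power ::
  "nat \<Rightarrow> (('x \<Rightarrow> complex) \<Rightarrow> 'x \<Rightarrow> complex) \<Rightarrow> ('x list \<Rightarrow> complex) \<Rightarrow> 'x list \<Rightarrow> complex" where
  "tensor_power 0 S F = (\<lambda>xs. if xs = [] then F [] else 0)"
| "tensor_power (Suc d) S F =
     (\<lambda>xs. case xs of
        [] \<Rightarrow> 0
      | x # ys \<Rightarrow> S (\<lambda>x'. tensor_power d S (\<lambda>ys'. F (x' # ys')) ys) x)"

definition tuples :: "nat \<Rightarrow> 'x set \<Rightarrow> 'x list set" where
  "tuples d X = {xs. length xs = d \<and> set xs \<subseteq> X}"

text \<open>
  Every finite-dimensional complex representation is isomorphic to one on a coordinate space,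
  so representations are given by matrices of some size \<open>k\<close>.
\<close>

definition is_rep :: "nat \<Rightarrow> nat \<Rightarrow> ('a::finite_field mat \<Rightarrow> complex mat) \<Rightarrow> bool" where
  "is_rep n k \<rho> \<longleftrightarrow>
     (\<forall>g\<in>SL n. \<rho> g \<in> carrier_mat k k) \<and>
     \<rho> (1\<^sub>m n) = 1\<^sub>m k \<and>
     (\<forall>g\<in>SL n. \<forall>h\<in>SL n. \<rho> (g * h) = \<rho> g * \<rho> h)"

definition is_irrep :: "nat \<Rightarrow> nat \<Rightarrow> ('a::finite_field mat \<Rightarrow> complex mat) \<Rightarrow> bool" where
  "is_irrep n k \<rho> \<longleftrightarrow>
     is_rep n k \<rho> \<and> k > 0 \<and>
     (\<forall>W. subspace class_ring W (module_vec TYPE(complex) k) \<and>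
          (\<forall>g\<in>SL n. \<forall>w\<in>W. \<rho> g *\<^sub>v w \<in> W) \<longrightarrow>
          W = {0\<^sub>v k} \<or> W = carrier_vec k)"

text \<open>
  \<open>\<rho>\<close> is a subrepresentation of the \<open>d\<close>-th tensor power of the permutation representation if it
  is isomorphic to an invariant subspace, i.e. if there is an injective linear equivariant map.
\<close>

definition subrep_tensor_power ::
  "nat \<Rightarrow> nat \<Rightarrow> ('a::finite_field mat \<Rightarrow> complex mat) \<Rightarrow> nat \<Rightarrow> bool" where
  "subrep_tensor_power n k \<rho> d \<longleftrightarrow>
     (\<exists>T :: complex vec \<Rightarrow> 'a vec list \<Rightarrow> complex.
        T \<in> carrier_vec k \<rightarrow> L2 (tuples d (carrier_vec n)) \<and>
        (\<forall>v\<in>carrier_vec k. \<forall>w\<in>carrier_vec k. \<forall>xs. T (v + w) xs = T v xs + T w xs) \<and>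
        (\<forall>c. \<forall>v\<in>carrier_vec k. \<forall>xs. T (c \<cdot>\<^sub>v v) xs = c * T v xs) \<and>
        inj_on T (carrier_vec k) \<and>
        (\<forall>g\<in>SL n. \<forall>v\<in>carrier_vec k. T (\<rho> g *\<^sub>v v) = tensor_power d (perm_rep n g) (T v)))"

definition has_tensor_rank ::
  "nat \<Rightarrow> nat \<Rightarrow> ('a::finite_field mat \<Rightarrow> complex mat) \<Rightarrow> nat \<Rightarrow> bool" where
  "has_tensor_rank n k \<rho> d \<longleftrightarrow>
     subrep_tensor_power n k \<rho> d \<and> (d > 0 \<longrightarrow> \<not> subrep_tensor_power n k \<rho> (d - 1))"

definition matrix_coeff ::
  "nat \<Rightarrow> ('a::finite_field mat \<Rightarrow> complex mat) \<Rightarrow> complex vec \<Rightarrow> complex vec \<Rightarrow> 'a mat \<Rightarrow> complex" where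
  "matrix_coeff n \<rho> v u = (\<lambda>g. if g \<in> SL n then (\<rho> g *\<^sub>v v) \<bullet>c u else 0)"

definition L2_SL_level :: "nat \<Rightarrow> nat \<Rightarrow> ('a::finite_field mat \<Rightarrow> complex) set" where
  "L2_SL_level n d = cfun.span
     {matrix_coeff n \<rho> v u | k \<rho> v u.
        is_irrep n k \<rho> \<and> has_tensor_rank n k \<rho> d \<and> v \<in> carrier_vec k \<and> u \<in> carrier_vec k}"


section \<open>Degree on the space of linear maps\<close>

text \<open>
  Linear maps are identified with their matrices in the standard basis. The sum below is the trace
  to the prime field, whose elements are the \<open>of_nat t\<close> with \<open>t < CHAR('a)\<close>; it has
  \<open>m\<close> terms where the field has \<open>CHAR('a) ^ m\<close> elements.
\<close>

definition field_trace :: "'a::finite_field \<Rightarrow> 'a" where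
  "field_trace x = (\<Sum>i<(THE m. CARD('a) = CHAR('a) ^ m). x ^ (CHAR('a) ^ i))"

definition add_char :: "'a::finite_field \<Rightarrow> complex" where
  "add_char x =
     exp (2 * of_real pi * \<i> / of_nat CHAR('a) *
          of_nat (THE t. t < CHAR('a) \<and> of_nat t = field_trace x))"

definition mat_trace :: "'a::finite_field mat \<Rightarrow> 'a" where
  "mat_trace A = (\<Sum>i<dim_row A. A $$ (i, i))"

definition fourier_char :: "nat \<Rightarrow> 'a::finite_field mat \<Rightarrow> 'a mat \<Rightarrow> complex" where
  "fourier_char n X = (\<lambda>A. if A \<in> carrier_mat n n then add_char (mat_trace (X * A)) else 0)"

definition fourier_coeff :: "nat \<Rightarrow> ('a::finite_field mat \<Rightarrow> complex) \<Rightarrow> 'a mat \<Rightarrow> complex" where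
  "fourier_coeff n f X = L2_inner (carrier_mat n n) f (fourier_char n X)"

definition degree_le_part ::
  "nat \<Rightarrow> nat \<Rightarrow> ('a::finite_field mat \<Rightarrow> complex) \<Rightarrow> 'a mat \<Rightarrow> complex" where
  "degree_le_part n d f =
     (\<lambda>A. \<Sum>X\<in>{X \<in> carrier_mat n n. vec_space.rank n X \<le> d}.
            fourier_coeff n f X * fourier_char n X A)"

definition ext_zero :: "nat \<Rightarrow> ('a::finite_field mat \<Rightarrow> complex) \<Rightarrow> 'a mat \<Rightarrow> complex" where
  "ext_zero n f = (\<lambda>A. if A \<in> SL n then f A else 0)"

end

theory Submission
  imports Defs "HOL-Number_Theory.Cong"
begin

text \<open>
  Restricting \<open>g \<in> SL(V)\<close> to a \<open>d\<close>-dimensional subspace \<open>U\<close> gives an orthogonal projection \<open>p\<^sub>U\<close> of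
  \<open>L\<^sup>2(SL(V))\<close> onto the functions of \<open>g|\<^sub>U\<close>. A function \<open>f\<close> of level \<open>d\<close> is orthogonal to all functions of
  \<open>g|\<^sub>W\<close> with \<open>dim W < d\<close>, so the Fourier coefficients of \<open>j(f)\<close> at \<open>X\<close> with \<open>rank X < d\<close> vanish and, grouping
  the \<open>X\<close> of rank \<open>d\<close> by their image \<open>U\<close>, Parseval's identity turns \<open>\<parallel>j(f)\<^sup>\<le>\<^sup>d\<parallel>\<^sup>2\<close> into a multiple of
  \<open>\<langle>S f, f\<rangle>\<close> with \<open>S = \<Sum>\<^sub>U p\<^sub>U\<close>. The operator \<open>S\<close> is central, so
  \<open>S\<^sup>2 = \<Sum>\<^sub>U\<^sub>,\<^sub>U\<^sub>' p\<^sub>U p\<^sub>U\<^sub>' p\<^sub>U \<ge> \<Sum>\<^sub>U p\<^sub>U = S\<close>; hence \<open>S \<ge> 1\<close> on its image, which contains \<open>f\<close>. What remains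
  is \<open>|SL(V)| \<ge> |L(V, V)| / (2q)\<close>.

  Subspaces are replaced by left invertible \<open>n \<times> d\<close> matrices \<open>B\<close>, with \<open>g|\<^sub>U\<close> becoming \<open>g B\<close>; each
  subspace is then counted \<open>|GL\<^sub>d|\<close> times.
\<close>

text \<open>The projections \<open>p_U\<close> do not commute with one another, so they have no
  common eigenbasis. The kernel of \<open>S\<close> at \<open>(x, y)\<close>, however, counts the
  \<open>U\<close> on which \<open>x\<close> and \<open>y\<close> agree, a number that depends only
  on the conjugacy class of \<open>y^-1 x\<close>. Hence \<open>S\<close> commutes with translations
  on both sides and so with each \<open>p_U\<close>.

  Tensor rank enters once through each half of its definition. Not embedding into the power
  \<open>d - 1\<close> makes the sums of \<open>f\<close> over the fibres of narrower restrictions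
  vanish; embedding into the power \<open>d\<close> puts \<open>f\<close> into the image of
  \<open>S\<close>.

  The bound is uniform in \<open>d\<close> because a power of \<open>q\<close> cancels: a fibre of
  \<open>g -> g B\<close> has at least \<open>|SL(V)| / q^(nd)\<close> elements, while character
  orthogonality over the \<open>d \<times> n\<close> matrices contributes \<open>q^(nd)\<close>.
  What is left is the factor \<open>|SL(V)| / |L(V, V)|\<close> between the two norms.\<close>

unbundle no vec_syntax

section \<open>The additive character\<close>

text \<open>The number of terms in \<open>field_trace\<close> is a definite description, so its
  existence has to be known. A largest additive subgroup of \<open>p\<close>-power order is the
  whole field, since adjoining one more element multiplies the order by \<open>p\<close>.\<close>

lemma finite_field_card_eq_CHAR_power:
  "\<exists>m. CARD('a::finite_field) = CHAR('a) ^ m"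
proof -
  define p where "p = CHAR('a)"
  have p: "prime p" unfolding p_def by simp
  define sub where "sub S \<longleftrightarrow> (0::'a) \<in> S \<and> (\<forall>x\<in>S. \<forall>y\<in>S. x - y \<in> S)" for S
  define P where "P S \<longleftrightarrow> sub S \<and> (\<exists>m. card S = p ^ m)" for S
  have "P {0}" unfolding P_def sub_def by (auto intro: exI[of _ 0])
  moreover have "\<forall>S. P S \<longrightarrow> card S < Suc CARD('a)" by (simp add: card_mono less_Suc_eq_le)
  ultimately obtain S where S: "P S" and max: "\<And>T. P T \<Longrightarrow> card T \<le> card S"
    using ex_has_greatest_nat[of P "{0}" card "Suc CARD('a)"] by blast
  obtain m where m: "card S = p ^ m" using S unfolding P_def by blast
  have S0: "0 \<in> S" and Sd: "\<And>x y. x \<in> S \<Longrightarrow> y \<in> S \<Longrightarrow> x - y \<in> S"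
    using S unfolding P_def sub_def by auto
  have Sneg: "- x \<in> S" if "x \<in> S" for x using Sd[OF S0 that] by simp
  have Sa: "x + y \<in> S" if "x \<in> S" "y \<in> S" for x y using Sd[OF that(1) Sneg[OF that(2)]] by simp
  have Sm: "of_nat k * x \<in> S" if "x \<in> S" for k x
    using that by (induction k) (auto simp: S0 Sa algebra_simps)
  have "S = UNIV"
  proof (rule ccontr)
    assume "S \<noteq> UNIV"
    then obtain x where x: "x \<notin> S" by blast
    define F where "F = (\<lambda>(s, k). s + of_nat k * x)"
    \<comment> \<open>A coincidence with distinct \<open>k\<close> and \<open>k'\<close> puts
      \<open>e x\<close> into \<open>S\<close> for some \<open>0 < e < p\<close>; inverting
      \<open>e\<close> modulo \<open>p\<close> would put \<open>x\<close> itself there.\<close>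
    have inj: "inj_on F (S \<times> {..<p})"
    proof (rule inj_onI, clarsimp simp: F_def)
      fix s k s' k' assume h: "s \<in> S" "s' \<in> S" "k < p" "k' < p"
        "s + of_nat k * x = s' + of_nat k' * x"
      have gen: "k = k'" if h: "s \<in> S" "s' \<in> S" "k < p" "k' < p" "k \<le> k'"
        "s + of_nat k * x = s' + of_nat k' * x" for s s' k k'
      proof (rule ccontr)
        assume "k \<noteq> k'"
        define e where "e = k' - k"
        have e: "0 < e" "e < p" "k' = k + e" using \<open>k \<noteq> k'\<close> h unfolding e_def by auto
        have ex: "of_nat e * x \<in> S"
          using Sd[OF h(1,2)] h(6) by (simp add: e algebra_simps)
        have "coprime e p" using p e by (meson coprime_commute nat_dvd_not_less prime_imp_coprime)
        then obtain b where b: "[e * b = 1] (mod p)" using cong_solve_coprime_nat by (metis One_nat_def)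
        have "of_nat (e * b) = (1 :: 'a)"
          using b of_nat_eq_iff_cong_CHAR[of "e*b" 1, where ?'a='a] unfolding p_def by simp
        then have "of_nat b * (of_nat e * x) = x"
          by (metis mult.assoc mult.commute mult_1 of_nat_mult)
        then show False using Sm[OF ex, of b] x by metis
      qed
      have "k = k'" using gen[of s s' k k'] gen[of s' s k' k] h by (metis nat_le_linear)
      then show "s = s' \<and> k = k'" using h by simp
    qed
    have "card (F ` (S \<times> {..<p})) = p ^ Suc m"
      by (simp add: card_image[OF inj] card_cartesian_product m)
    moreover have "sub (F ` (S \<times> {..<p}))"
      unfolding sub_def
    proof (intro conjI ballI)
      show "0 \<in> F ` (S \<times> {..<p})"
        using S0 p by (intro image_eqI[of _ _ "(0, 0)"]) (auto simp: F_def prime_gt_0_nat)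
      fix u v assume "u \<in> F ` (S \<times> {..<p})" "v \<in> F ` (S \<times> {..<p})"
      then obtain s k s' k' where h: "s \<in> S" "s' \<in> S" "k < p" "k' < p"
        "u = s + of_nat k * x" "v = s' + of_nat k' * x" by (auto simp: F_def)
      have "of_nat ((k + p - k') mod p) = (of_nat (k + p - k') :: 'a)"
        using of_nat_eq_iff_cong_CHAR[where ?'a='a, of "(k + p - k') mod p" "k + p - k'"]
        unfolding p_def by (simp add: cong_def)
      also have "\<dots> = of_nat k - of_nat k'" using h by (simp add: of_nat_diff p_def)
      finally have eq: "of_nat ((k + p - k') mod p) = (of_nat k - of_nat k' :: 'a)" .
      have "u - v = F (s - s', (k + p - k') mod p)"
        unfolding h F_def prod.case eq by (simp add: algebra_simps)
      then show "u - v \<in> F ` (S \<times> {..<p})"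
        using Sd[OF h(1,2)] p by (auto simp: prime_gt_0_nat)
    qed
    ultimately have "P (F ` (S \<times> {..<p}))" unfolding P_def by blast
    from max[OF this] have "p ^ Suc m \<le> p ^ m"
      using \<open>card (F ` (S \<times> {..<p})) = p ^ Suc m\<close> m by simp
    then show False using prime_gt_1_nat[OF p] by simp
  qed
  then show ?thesis using m unfolding p_def by blast
qed

lemma field_trace_power_sum:
  obtains m where "CARD('a::finite_field) = CHAR('a) ^ m" "m > 0"
    "\<And>x::'a. field_trace x = (\<Sum>i<m. x ^ (CHAR('a) ^ i))"
proof -
  obtain m where m: "CARD('a) = CHAR('a) ^ m" using finite_field_card_eq_CHAR_power by blast
  have p: "CHAR('a) > 1" by (rule prime_gt_1_nat) simp
  have "(THE m. CARD('a) = CHAR('a) ^ m) = m"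
    using p by (intro the_equality) (auto simp: m)
  moreover have "m > 0"
  proof (rule ccontr)
    assume "\<not> m > 0"
    then have "CARD('a) = 1" using m by simp
    then show False using card_2_iff'[of "UNIV::'a set"]
      by (metis (full_types) UNIV_I card_1_singletonE singletonD zero_neq_one)
  qed
  ultimately show ?thesis using that m unfolding field_trace_def by auto
qed

lemma field_trace_add: "field_trace (x + y) = field_trace x + field_trace (y::'a::finite_field)"
proof -
  obtain m where m: "\<And>x::'a. field_trace x = (\<Sum>i<m. x ^ (CHAR('a) ^ i))"
    using field_trace_power_sum by metis
  show ?thesis unfolding m by (simp add: freshmans_dream' sum.distrib)
qed

text \<open>The \<open>p\<close>-th power shifts the terms of the trace cyclically, because
  \<open>x ^ CARD('a) = x\<close>. With \<open>frobenius_fixed_of_nat\<close> this shows that the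
  number \<open>t\<close> described in \<open>add_char\<close> exists.\<close>

lemma field_trace_frobenius: "field_trace x ^ CHAR('a) = field_trace (x::'a::finite_field)"
proof -
  obtain m where q: "CARD('a) = CHAR('a) ^ m" and m: "m > 0"
    "\<And>x::'a. field_trace x = (\<Sum>i<m. x ^ (CHAR('a) ^ i))"
    using field_trace_power_sum by metis
  have "field_trace x ^ CHAR('a) = (\<Sum>i<m. x ^ (CHAR('a) ^ Suc i))"
    unfolding m by (simp add: freshmans_dream_sum power_mult [symmetric] mult.commute)
  also have "\<dots> + x = (\<Sum>i<Suc m. x ^ (CHAR('a) ^ i))"
    unfolding sum.lessThan_Suc_shift by (simp add: add.commute)
  also have "\<dots> = field_trace x + x"
    using finite_field_power_card_eq_same[of x] by (simp add: m q)
  finally show ?thesis by simp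
qed

text \<open>As a polynomial the trace has linear coefficient 1 and degree at most
  \<open>CARD('a) / CHAR('a)\<close>, too few roots for it to vanish everywhere.\<close>

lemma field_trace_nonzero: "\<exists>x::'a::finite_field. field_trace x \<noteq> 0"
proof (rule ccontr)
  assume *: "\<not> ?thesis"
  obtain m where q: "CARD('a) = CHAR('a) ^ m" and m: "m > 0"
    "\<And>x::'a. field_trace x = (\<Sum>i<m. x ^ (CHAR('a) ^ i))"
    using field_trace_power_sum by metis
  have p: "CHAR('a) > 1" by (rule prime_gt_1_nat) simp
  define T :: "'a poly" where "T = (\<Sum>i<m. monom 1 (CHAR('a) ^ i))"
  have "poly.coeff T 1 = (\<Sum>i<m. if i = 0 then 1 else 0)"
    unfolding T_def using p by (auto simp: coeff_sum intro!: sum.cong)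
  then have "T \<noteq> 0" using m by auto
  moreover have "poly T x = 0" for x
    using * m(2)[of x] by (simp add: T_def poly_sum poly_monom)
  ultimately have "CARD('a) \<le> degree T" using card_poly_roots_bound[of T] by simp
  also have "degree T \<le> CHAR('a) ^ (m - 1)"
    unfolding T_def
  proof (rule degree_sum_le)
    fix i assume "i \<in> {..<m}"
    then show "degree (monom (1::'a) (CHAR('a) ^ i)) \<le> CHAR('a) ^ (m - 1)"
      using p by (simp add: degree_monom_eq)
  qed simp
  also have "\<dots> < CARD('a)" unfolding q using p m by simp
  finally show False by simp
qed

text \<open>The multiples of 1 by \<open>0, ..., p - 1\<close> are already \<open>p\<close> distinct
  roots of \<open>X^p - X\<close>, hence all of them.\<close>

lemma frobenius_fixed_of_nat:
  fixes x :: "'a::finite_field"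
  assumes "x ^ CHAR('a) = x"
  shows "\<exists>t<CHAR('a). of_nat t = x"
proof -
  define p where "p = CHAR('a)"
  have p: "p > 1" unfolding p_def by (rule prime_gt_1_nat) simp
  define T :: "'a poly" where "T = monom 1 p - monom 1 1"
  have "poly.coeff T p = 1" unfolding T_def using p by (auto simp: coeff_monom)
  then have T0: "T \<noteq> 0" by auto
  have "degree T \<le> p" unfolding T_def
    using p by (intro degree_diff_le) (auto simp: degree_monom_eq)
  then have cd: "card {x. poly T x = 0} \<le> p" using card_poly_roots_bound[OF T0] by simp
  have inj: "inj_on (of_nat :: nat \<Rightarrow> 'a) {..<p}"
    by (rule inj_onI) (auto simp: of_nat_eq_iff_cong_CHAR p_def cong_def)
  have sub: "of_nat ` {..<p} \<subseteq> {x::'a. poly T x = 0}"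
  proof clarsimp
    fix k show "poly T (of_nat k) = 0"
    proof (induction k)
      case 0 then show ?case using p by (simp add: T_def poly_monom)
    next
      case (Suc k)
      then show ?case using freshmans_dream[of p "1::'a" "of_nat k"]
        by (simp add: T_def poly_monom p_def)
    qed
  qed
  have "of_nat ` {..<p} = {x::'a. poly T x = 0}"
    using cd card_image[OF inj] by (intro card_seteq sub) auto
  moreover have "poly T x = 0" using assms by (simp add: T_def poly_monom p_def)
  ultimately have "x \<in> of_nat ` {..<p}" by simp
  then show ?thesis unfolding p_def by auto
qed

text \<open>Any representative \<open>k\<close> of the trace modulo the characteristic may stand for
  the least one, which spares a reduction when traces are added.\<close>

lemma add_char_eq_cis:
  fixes x :: "'a::finite_field"
  assumes "of_nat k = field_trace x"
  shows "add_char x = cis (2 * pi * real k / real CHAR('a))"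
proof -
  define p where "p = CHAR('a)"
  have p: "p > 0" by (simp add: p_def)
  have ex: "\<exists>t<p. of_nat t = field_trace x"
    using frobenius_fixed_of_nat[OF field_trace_frobenius] unfolding p_def by blast
  then obtain t where t: "t < p" "of_nat t = field_trace x" by blast
  have "(THE t. t < p \<and> of_nat t = field_trace x) = t"
    using t by (intro the_equality) (auto simp: of_nat_eq_iff_cong_CHAR cong_def p_def simp flip: t(2))
  then have "add_char x = exp (2 * of_real pi * \<i> / of_nat p * of_nat t)"
    unfolding add_char_def p_def by simp
  also have "\<dots> = cis (2 * pi * real t / real p)"
    unfolding cis_conv_exp by (simp add: field_simps)
  also have "\<dots> = cis (2 * pi * real k / real p)"
  proof -
    have "[k = t] (mod p)"
      using assms t of_nat_eq_iff_cong_CHAR[of k t, where ?'a='a] by (simp add: p_def)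
    then have "k mod p = t" using t by (simp add: cong_def)
    then obtain j where j: "k = p * j + t" using mult_div_mod_eq[of p k] by metis
    have "2 * pi * real k / real p = 2 * pi * real t / real p + 2 * pi * real j"
      using p by (simp add: j field_simps)
    then show ?thesis by (simp add: cis_mult[symmetric] cis_multiple_2pi)
  qed
  finally show ?thesis unfolding p_def .
qed

lemma field_trace_of_nat: "\<exists>k. of_nat k = field_trace (x::'a::finite_field)"
  using frobenius_fixed_of_nat[OF field_trace_frobenius] by blast

lemma add_char_add: "add_char (x + y) = add_char x * add_char (y::'a::finite_field)"
proof -
  obtain k l where k: "of_nat k = field_trace x" "of_nat l = field_trace y"
    using field_trace_of_nat by metis
  have "of_nat (k + l) = field_trace (x + y)" by (simp add: k field_trace_add)
  from add_char_eq_cis[OF this] add_char_eq_cis[OF k(1)] add_char_eq_cis[OF k(2)]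
  show ?thesis by (simp add: cis_mult add_divide_distrib distrib_left)
qed

lemma norm_add_char [simp]: "norm (add_char (x::'a::finite_field)) = 1"
  using field_trace_of_nat[of x] add_char_eq_cis by (metis norm_cis)

lemma add_char_0 [simp]: "add_char (0::'a::finite_field) = 1"
  using add_char_add[of 0 "0::'a"] norm_add_char[of "0::'a"]
  by (metis add_0 mult_cancel_right1 norm_zero zero_neq_one)

lemma add_char_minus: "add_char (- x) = cnj (add_char (x::'a::finite_field))"
proof -
  have "add_char (- x) * add_char x = 1" by (simp flip: add_char_add)
  moreover have "cnj (add_char x) * add_char x = 1"
    using complex_norm_square[of "add_char x"] by (simp add: mult.commute)
  ultimately show ?thesis
    by (metis mult_right_cancel mult_zero_right zero_neq_one)
qed

lemma add_char_diff: "add_char (x - y) = add_char x * cnj (add_char (y::'a::finite_field))"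
  using add_char_add[of x "- y"] by (simp add: add_char_minus)

lemma add_char_nontrivial: "\<exists>x::'a::finite_field. add_char x \<noteq> 1"
proof -
  obtain x :: 'a where x: "field_trace x \<noteq> 0" using field_trace_nonzero by blast
  obtain k where k: "k < CHAR('a)" "of_nat k = field_trace x"
    using frobenius_fixed_of_nat[OF field_trace_frobenius] by blast
  have "k > 0" using x k by (metis gr0I of_nat_0)
  have "add_char x \<noteq> 1"
  proof
    assume "add_char x = 1"
    then have "cis (2 * pi * real k / real CHAR('a)) = 1" using add_char_eq_cis[OF k(2)] by simp
    then have "cos (2 * pi * real k / real CHAR('a)) = 1" by (metis cis.simps(1) one_complex.simps(1))
    then obtain n :: int where "2 * pi * real k / real CHAR('a) = of_int n * 2 * pi"
      using cos_one_2pi_int by blast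
    then have "real k = of_int n * real CHAR('a)"
      by (simp add: field_simps)
    then have "int k = n * int CHAR('a)"
      by (metis of_int_eq_iff of_int_mult of_int_of_nat_eq)
    then have "CHAR('a) dvd k" by (metis dvd_triv_right of_nat_dvd_iff)
    then show False using k \<open>k > 0\<close> by (simp add: nat_dvd_not_less)
  qed
  then show ?thesis by blast
qed

section \<open>Sums of commuting fibre averages\<close>

text \<open>Without the division by \<open>card G\<close> of \<open>L2_inner\<close>, so that the
  operators below have integer kernels; the normalisation returns only when norms are
  compared.\<close>

definition ip :: "'x set \<Rightarrow> ('x \<Rightarrow> complex) \<Rightarrow> ('x \<Rightarrow> complex) \<Rightarrow> complex" where
  "ip G f g = (\<Sum>x\<in>G. f x * cnj (g x))"

lemma ip_cong:
  "(\<And>x. x \<in> G \<Longrightarrow> f x = f' x) \<Longrightarrow> (\<And>x. x \<in> G \<Longrightarrow> g x = g' x) \<Longrightarrow> ip G f g = ip G f' g'"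
  unfolding ip_def by (rule sum.cong) auto

lemma ip_sum_left: "ip G (\<lambda>x. \<Sum>i\<in>I. f i x) g = (\<Sum>i\<in>I. ip G (f i) g)"
  unfolding ip_def by (simp add: sum_distrib_right sum.swap[of _ G])

lemma ip_scale_left: "ip G (\<lambda>x. c * f x) g = c * ip G f g"
  unfolding ip_def by (simp add: sum_distrib_left mult.assoc)

lemma ip_diff_left: "ip G (\<lambda>x. f x - f' x) g = ip G f g - ip G f' g"
  unfolding ip_def by (simp add: sum_subtractf left_diff_distrib)

lemma ip_commute: "ip G g f = cnj (ip G f g)"
  unfolding ip_def by (simp add: mult.commute)

lemma ip_diff_right: "ip G g (\<lambda>x. f x - f' x) = ip G g f - ip G g f'"
  unfolding ip_commute[of G g] ip_diff_left by simp

lemma ip_scale_right: "ip G g (\<lambda>x. c * f x) = cnj c * ip G g f"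
  unfolding ip_commute[of G g] ip_scale_left by simp

lemma ip_sum_right: "ip G g (\<lambda>x. \<Sum>i\<in>I. f i x) = (\<Sum>i\<in>I. ip G g (f i))"
  unfolding ip_commute[of G g] ip_sum_left by simp

lemma ip_self: "ip G f f = of_real (\<Sum>x\<in>G. (cmod (f x))\<^sup>2)"
  unfolding ip_def by (simp only: of_real_sum complex_norm_square)

lemma ip_self_nonneg: "0 \<le> Re (ip G f f)"
  unfolding ip_self by (simp add: sum_nonneg)

lemma ip_self_eq_0_iff: "finite G \<Longrightarrow> ip G f f = 0 \<longleftrightarrow> (\<forall>x\<in>G. f x = 0)"
  unfolding ip_self of_real_eq_0_iff by (simp add: sum_nonneg_eq_0_iff)

text \<open>Gram-Schmidt, with \<open>b'\<close> the part of \<open>b y\<close> orthogonal to the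
  earlier vectors. It supplies the orthogonal projection onto the span of a finite family, dependent
  or not.\<close>

lemma orthogonal_residual_exists:
  assumes "finite G" "finite Z"
  shows "\<exists>c. \<forall>z\<in>Z. ip G (\<lambda>x. f x - (\<Sum>w\<in>Z. c w * b w x)) (b z) = 0"
  using \<open>finite Z\<close>
proof (induction Z arbitrary: f)
  case empty
  show ?case by simp
next
  case (insert y Z)
  obtain c where c: "\<And>z. z \<in> Z \<Longrightarrow> ip G (\<lambda>x. f x - (\<Sum>w\<in>Z. c w * b w x)) (b z) = 0"
    using insert.IH[of f] by blast
  obtain e where e: "\<And>z. z \<in> Z \<Longrightarrow> ip G (\<lambda>x. b y x - (\<Sum>w\<in>Z. e w * b w x)) (b z) = 0"
    using insert.IH[of "b y"] by blast
  define f' where "f' = (\<lambda>x. f x - (\<Sum>w\<in>Z. c w * b w x))"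
  define b' where "b' = (\<lambda>x. b y x - (\<Sum>w\<in>Z. e w * b w x))"
  \<comment> \<open>If \<open>b'\<close> vanishes on \<open>G\<close>, division by zero makes
    \<open>t\<close> equal to 0, and \<open>f'\<close> is orthogonal to \<open>b'\<close>
    anyway.\<close>
  define t where "t = ip G f' b' / ip G b' b'"
  define c' where "c' = (\<lambda>w. if w = y then t else c w - t * e w)"
  define r where "r = (\<lambda>x. f' x - t * b' x)"
  have r: "(\<lambda>x. f x - (\<Sum>w\<in>insert y Z. c' w * b w x)) = r"
  proof
    fix x
    have "(\<Sum>w\<in>Z. c' w * b w x) = (\<Sum>w\<in>Z. c w * b w x) - t * (\<Sum>w\<in>Z. e w * b w x)"
      unfolding sum_distrib_left sum_subtractf[symmetric] using insert.hyps
      by (intro sum.cong) (auto simp: c'_def algebra_simps)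
    then show "f x - (\<Sum>w\<in>insert y Z. c' w * b w x) = r x"
      using insert.hyps by (simp add: r_def f'_def b'_def c'_def algebra_simps)
  qed
  have rZ: "ip G r (b z) = 0" if "z \<in> Z" for z
    using c[OF that] e[OF that]
    unfolding r_def ip_diff_left ip_scale_left f'_def[symmetric] b'_def[symmetric] by simp
  have "ip G f' b' = 0" if "ip G b' b' = 0"
  proof -
    have "ip G f' b' = ip G f' (\<lambda>x. 0)"
      using that \<open>finite G\<close> by (intro ip_cong) (auto simp: ip_self_eq_0_iff)
    then show ?thesis by (simp add: ip_def)
  qed
  then have rb': "ip G r b' = 0"
    unfolding r_def ip_diff_left ip_scale_left t_def by auto
  have "ip G r (b y) = ip G r (\<lambda>x. b' x - (\<Sum>w\<in>Z. - e w * b w x))"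
    by (simp add: b'_def sum_negf)
  also have "\<dots> = 0"
    unfolding ip_diff_right ip_sum_right ip_scale_right using rb' rZ by simp
  finally show ?case using rZ by (intro exI[of _ c']) (auto simp: r)
qed

text \<open>Restriction to subspaces in abstract form: \<open>r i\<close> is the restriction map,
  \<open>h i\<close> the size of its fibres, bounded below by \<open>m\<close>, and \<open>c\<close>
  is a lower bound for the number of indices with the same fibres as \<open>i\<close>. The two sides
  of \<open>commuting\<close> are the kernels at \<open>(x, z)\<close> of \<open>K\<close> after
  \<open>P i\<close> and of \<open>P i\<close> after \<open>K\<close>.\<close>

locale fibre_sums =
  fixes G :: "'x set" and I :: "'i set" and r :: "'i \<Rightarrow> 'x \<Rightarrow> 'y"
    and h :: "'i \<Rightarrow> nat" and m c :: real
  assumes finite_G: "finite G" and finite_I: "finite I"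
    and m_pos: "0 < m" and c_nonneg: "0 \<le> c"
    and card_fibre: "\<And>i x. i \<in> I \<Longrightarrow> x \<in> G \<Longrightarrow> card {y\<in>G. r i y = r i x} = h i"
    and card_fibre_ge: "\<And>i. i \<in> I \<Longrightarrow> m \<le> real (h i)"
    and multiplicity: "\<And>i. i \<in> I \<Longrightarrow>
      c \<le> real (card {j\<in>I. \<forall>x\<in>G. \<forall>y\<in>G. r j x = r j y \<longleftrightarrow> r i x = r i y})"
    and commuting: "\<And>i x z. i \<in> I \<Longrightarrow> x \<in> G \<Longrightarrow> z \<in> G \<Longrightarrow>
      (\<Sum>y\<in>{y\<in>G. r i y = r i z}. card {j\<in>I. r j x = r j y}) =
      (\<Sum>y\<in>{y\<in>G. r i y = r i x}. card {j\<in>I. r j y = r j z})"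
begin

text \<open>This is \<open>h i\<close> times the orthogonal projection onto the functions constant
  on the fibres of \<open>r i\<close>. Sums instead of averages avoid denominators, at the price of
  \<open>P_P\<close> in place of idempotence.\<close>

definition P :: "'i \<Rightarrow> ('x \<Rightarrow> complex) \<Rightarrow> 'x \<Rightarrow> complex" where
  "P i f x = (\<Sum>y\<in>{y\<in>G. r i y = r i x}. f y)"

definition K :: "('x \<Rightarrow> complex) \<Rightarrow> 'x \<Rightarrow> complex" where
  "K f x = (\<Sum>i\<in>I. P i f x)"

lemma h_pos: "i \<in> I \<Longrightarrow> 0 < h i"
  using card_fibre_ge[of i] m_pos by linarith

lemma P_cong: "(\<And>x. x \<in> G \<Longrightarrow> f x = g x) \<Longrightarrow> P i f = P i g"
  unfolding P_def by (intro ext sum.cong) auto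

lemma K_cong: "(\<And>x. x \<in> G \<Longrightarrow> f x = g x) \<Longrightarrow> K f = K g"
  unfolding K_def using P_cong[of f g] by auto

lemma P_kernel: "P i f x = (\<Sum>y\<in>G. of_bool (r i y = r i x) * f y)"
  unfolding P_def using finite_G by (intro sum.mono_neutral_cong_left) auto

lemma P_selfadjoint: "ip G (P i f) g = ip G f (P i g)"
  unfolding ip_def P_kernel cnj_sum sum_distrib_left sum_distrib_right
  by (subst sum.swap) (intro sum.cong refl, auto)

lemma P_linear: "P i (\<lambda>x. \<Sum>z\<in>Z. a z * b z x) x = (\<Sum>z\<in>Z. a z * P i (b z) x)"
  unfolding P_def by (subst sum.swap) (simp add: sum_distrib_left)

lemma P_P: "i \<in> I \<Longrightarrow> x \<in> G \<Longrightarrow> P i (P i f) x = of_nat (h i) * P i f x"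
proof -
  assume i: "i \<in> I" "x \<in> G"
  have "P i (P i f) x = (\<Sum>y\<in>{y\<in>G. r i y = r i x}. P i f x)"
    unfolding P_def by (intro sum.cong) auto
  also have "\<dots> = of_nat (h i) * P i f x"
    using card_fibre[OF i] by simp
  finally show ?thesis .
qed

lemma K_selfadjoint: "ip G (K f) g = ip G f (K g)"
proof -
  have "ip G (K f) g = (\<Sum>i\<in>I. ip G (P i f) g)"
    unfolding ip_sum_left[symmetric] by (intro ip_cong) (auto simp: K_def)
  also have "\<dots> = (\<Sum>i\<in>I. ip G f (P i g))" by (simp add: P_selfadjoint)
  also have "\<dots> = ip G f (K g)"
    unfolding ip_sum_right[symmetric] by (intro ip_cong) (auto simp: K_def)
  finally show ?thesis .
qed

lemma K_linear: "K (\<lambda>x. \<Sum>z\<in>Z. a z * b z x) x = (\<Sum>z\<in>Z. a z * K (b z) x)"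
  unfolding K_def P_linear sum_distrib_left by (rule sum.swap)

lemma K_kernel: "K f x = (\<Sum>y\<in>G. of_nat (card {j\<in>I. r j x = r j y}) * f y)"
proof -
  have "K f x = (\<Sum>y\<in>G. (\<Sum>i\<in>I. of_bool (r i y = r i x)) * f y)"
    unfolding K_def P_kernel sum_distrib_right by (rule sum.swap)
  also have "\<dots> = (\<Sum>y\<in>G. of_nat (card {j\<in>I. r j x = r j y}) * f y)"
    using finite_I by (intro sum.cong refl) (simp add: Int_def eq_commute)
  finally show ?thesis .
qed

lemma K_P: "i \<in> I \<Longrightarrow> x \<in> G \<Longrightarrow> K (P i f) x = P i (K f) x"
proof -
  assume i: "i \<in> I" "x \<in> G"
  let ?k = "\<lambda>x y. of_nat (card {j\<in>I. r j x = r j y}) :: complex"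
  have sw: "(\<Sum>y\<in>G. of_bool (r i z = r i y) * ?k x y) = (\<Sum>y\<in>{y\<in>G. r i y = r i z}. ?k x y)" for z
    using finite_G by (intro sum.mono_neutral_cong_right) auto
  have sw': "(\<Sum>y\<in>G. of_bool (r i y = r i x) * ?k y z) = (\<Sum>y\<in>{y\<in>G. r i y = r i x}. ?k y z)" for z
    using finite_G by (intro sum.mono_neutral_cong_right) auto
  have "K (P i f) x = (\<Sum>z\<in>G. (\<Sum>y\<in>G. of_bool (r i z = r i y) * ?k x y) * f z)"
    unfolding K_kernel P_kernel sum_distrib_left sum_distrib_right
    by (subst sum.swap) (simp add: mult_ac)
  also have "\<dots> = (\<Sum>z\<in>G. (\<Sum>y\<in>G. of_bool (r i y = r i x) * ?k y z) * f z)"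
    unfolding sw sw' of_nat_sum[symmetric] using commuting[OF i] by (intro sum.cong) auto
  also have "\<dots> = P i (K f) x"
    unfolding K_kernel P_kernel sum_distrib_left sum_distrib_right
    by (subst sum.swap) (simp add: mult_ac)
  finally show ?thesis .
qed

lemma ip_P_P: "i \<in> I \<Longrightarrow> ip G (P i f) (P i g) = of_nat (h i) * ip G (P i f) g"
  unfolding P_selfadjoint[symmetric] ip_scale_left[symmetric]
  by (rule ip_cong) (auto simp: P_P)

lemma ip_P_nonneg: "i \<in> I \<Longrightarrow> 0 \<le> Re (ip G (P i f) f)"
  using ip_self_nonneg[of G "P i f"] h_pos[of i] by (simp add: ip_P_P zero_le_mult_iff)

lemma ip_K_eq_sum: "ip G (K f) g = (\<Sum>i\<in>I. ip G (P i f) g)"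
  unfolding ip_sum_left[symmetric] by (intro ip_cong) (auto simp: K_def)

lemma ip_KK_eq_sum: "ip G (K (K f)) g = (\<Sum>i\<in>I. ip G (K (P i f)) g)"
proof -
  have "K f = (\<lambda>x. \<Sum>i\<in>I. 1 * P i f x)" by (simp add: K_def fun_eq_iff)
  then have "K (K f) x = (\<Sum>i\<in>I. K (P i f) x)" for x
    using K_linear[of "\<lambda>_. 1" "\<lambda>i. P i f" I x] by simp
  then show ?thesis unfolding ip_sum_left[symmetric] by (simp cong: ip_cong)
qed

lemma ip_K_P: "i \<in> I \<Longrightarrow> ip G (K (P i f)) (P i f) = of_nat (h i) * ip G (K (P i f)) f"
proof -
  assume i: "i \<in> I"
  have "ip G (K (P i f)) (P i f) = ip G (P i (K f)) (P i f)"
    by (rule ip_cong) (auto simp: K_P i)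
  also have "\<dots> = of_nat (h i) * ip G (P i (K f)) f" by (rule ip_P_P[OF i])
  also have "ip G (P i (K f)) f = ip G (K (P i f)) f"
    by (rule ip_cong) (auto simp: K_P i)
  finally show ?thesis .
qed

lemma P_eqI:
  assumes "\<forall>x\<in>G. \<forall>y\<in>G. r j x = r j y \<longleftrightarrow> r i x = r i y" "x \<in> G"
  shows "P j f x = P i f x"
  unfolding P_def using assms by (intro sum.cong) auto

text \<open>
  Since \<open>K\<close> commutes with \<open>P i\<close>, the form of \<open>h i * K (P i f)\<close> at \<open>f\<close> is that of \<open>K\<close> at \<open>P i f\<close>, a sum of
  nonnegative terms of which only those with the same fibres as \<open>i\<close> are kept.
\<close>

lemma ip_K_P_ge:
  assumes i: "i \<in> I"
  shows "c * m * Re (ip G (P i f) f) \<le> Re (ip G (K (P i f)) f)"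
proof -
  define J where "J = {j\<in>I. \<forall>x\<in>G. \<forall>y\<in>G. r j x = r j y \<longleftrightarrow> r i x = r i y}"
  define a where "a = Re (ip G (P i f) f)"
  have a: "0 \<le> a" unfolding a_def by (rule ip_P_nonneg[OF i])
  have "real (card J) * (real (h i))\<^sup>2 * a = (\<Sum>j\<in>J. Re (ip G (P j (P i f)) (P i f)))"
  proof -
    have "ip G (P j (P i f)) (P i f) = (of_nat (h i))\<^sup>2 * ip G (P i f) f" if "j \<in> J" for j
    proof -
      have "ip G (P j (P i f)) (P i f) = ip G (P i (P i f)) (P i f)"
        using that by (intro ip_cong refl P_eqI) (auto simp: J_def)
      also have "\<dots> = of_nat (h i) * ip G (P i (P i f)) f" by (rule ip_P_P[OF i])
      also have "ip G (P i (P i f)) f = of_nat (h i) * ip G (P i f) f"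
        unfolding P_selfadjoint[of i "P i f"] by (rule ip_P_P[OF i])
      finally show ?thesis by (simp add: power2_eq_square)
    qed
    then show ?thesis by (simp add: a_def flip: of_nat_power)
  qed
  also have "\<dots> \<le> (\<Sum>j\<in>I. Re (ip G (P j (P i f)) (P i f)))"
    by (intro sum_mono2 finite_I ip_P_nonneg) (auto simp: J_def)
  also have "\<dots> = Re (ip G (K (P i f)) (P i f))" unfolding ip_K_eq_sum by simp
  also have "\<dots> = real (h i) * Re (ip G (K (P i f)) f)" unfolding ip_K_P[OF i] by simp
  finally have "real (h i) * (real (card J) * real (h i) * a) \<le> real (h i) * Re (ip G (K (P i f)) f)"
    by (simp add: power2_eq_square mult_ac)
  then have "real (card J) * real (h i) * a \<le> Re (ip G (K (P i f)) f)"
    using h_pos[OF i] by simp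
  moreover have "c * m * a \<le> real (card J) * real (h i) * a"
    using multiplicity[OF i] card_fibre_ge[OF i] m_pos c_nonneg a unfolding J_def[symmetric]
    by (intro mult_right_mono mult_mono) auto
  ultimately show ?thesis unfolding a_def by linarith
qed

lemma ip_KK_ge: "c * m * Re (ip G (K f) f) \<le> Re (ip G (K (K f)) f)"
  unfolding ip_K_eq_sum[of f f] ip_KK_eq_sum Re_sum sum_distrib_left
  by (intro sum_mono ip_K_P_ge)

text \<open>Since \<open>P i\<close> commutes with \<open>K\<close>, replacing \<open>f\<close> by
  \<open>P i f\<close> in the second argument only costs the factor \<open>h i\<close>. So
  \<open>ip_KK_ge\<close> at \<open>P i f\<close>, divided by \<open>h i\<close>, is the
  \<open>i\<close>-th summand here, and no square root of \<open>K\<close> is needed to insert the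
  extra factor.\<close>

lemma ip_KKK_ge: "c * m * Re (ip G (K (K f)) f) \<le> Re (ip G (K (K (K f))) f)"
proof -
  have eq: "ip G (K (K (K f))) f = (\<Sum>i\<in>I. ip G (K (K (P i f))) f)"
    unfolding K_selfadjoint[of "K (K f)"] ip_KK_eq_sum[of f]
    by (simp add: K_selfadjoint[symmetric])
  have "c * m * Re (ip G (K (P i f)) f) \<le> Re (ip G (K (K (P i f))) f)" if i: "i \<in> I" for i
  proof -
    have "ip G (K (K (P i f))) (P i f) = ip G (K (P i (K f))) (P i f)"
      using K_cong[of "K (P i f)" "P i (K f)"] K_P[OF i] by simp
    also have "\<dots> = ip G (P i (K (K f))) (P i f)"
      by (intro ip_cong) (auto simp: K_P i)
    also have "\<dots> = of_nat (h i) * ip G (P i (K (K f))) f" by (rule ip_P_P[OF i])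
    also have "ip G (P i (K (K f))) f = ip G (K (P i (K f))) f"
      by (intro ip_cong) (auto simp: K_P i)
    also have "\<dots> = ip G (K (K (P i f))) f"
      using K_cong[of "K (P i f)" "P i (K f)"] K_P[OF i] by simp
    finally have "real (h i) * (c * m * Re (ip G (K (P i f)) f)) \<le> real (h i) * Re (ip G (K (K (P i f))) f)"
      using ip_KK_ge[of "P i f"] unfolding ip_K_P[OF i] by (simp add: mult_ac)
    then show ?thesis using h_pos[OF i] by simp
  qed
  then show ?thesis
    unfolding eq ip_KK_eq_sum[of f] Re_sum sum_distrib_left by (intro sum_mono)
qed

text \<open>
  Two applications of \<open>c m K \<le> K\<^sup>2\<close> give \<open>c m K\<^sup>2 \<le> K\<^sup>3\<close>, which is the claim for \<open>f = K g\<close>; the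
  hypothesis on \<open>f\<close> excludes a component in the kernel of \<open>K\<close>.
\<close>

lemma ip_K_ge:
  assumes f: "\<And>k. (\<And>i x. i \<in> I \<Longrightarrow> x \<in> G \<Longrightarrow> P i k x = 0) \<Longrightarrow> ip G f k = 0"
  shows "c * m * Re (ip G f f) \<le> Re (ip G (K f) f)"
proof -
  define \<delta> :: "'x \<Rightarrow> 'x \<Rightarrow> complex" where "\<delta> z x = (if x = z then 1 else 0)" for z x
  \<comment> \<open>The functions \<open>K (\<delta> z)\<close> span the range of \<open>K\<close>
    on \<open>G\<close>. The remainder \<open>f - K g\<close> is orthogonal to that range, hence
    killed by the self-adjoint \<open>K\<close>.\<close>
  obtain a where a: "\<And>z. z \<in> G \<Longrightarrow> ip G (\<lambda>x. f x - (\<Sum>w\<in>G. a w * K (\<delta> w) x)) (K (\<delta> z)) = 0"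
    using orthogonal_residual_exists[OF finite_G finite_G, of f "\<lambda>z. K (\<delta> z)"] by blast
  define g where "g x = (\<Sum>w\<in>G. a w * \<delta> w x)" for x
  define k where "k x = f x - K g x" for x
  have Kg: "K g x = (\<Sum>w\<in>G. a w * K (\<delta> w) x)" for x
    unfolding g_def by (rule K_linear)
  have Kk: "K k z = 0" if "z \<in> G" for z
  proof -
    have "K k z = ip G (K k) (\<delta> z)" using that finite_G by (simp add: ip_def \<delta>_def if_distrib[of cnj] if_distrib[of "\<lambda>u. _ * u"] cong: if_cong)
    also have "\<dots> = 0" unfolding K_selfadjoint using a[OF that] by (simp add: k_def[abs_def] Kg)
    finally show ?thesis .
  qed
  then have "ip G (K k) k = 0" by (simp add: ip_def)
  \<comment> \<open>All summands are nonnegative, so each \<open>P i k\<close> vanishes on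
    \<open>G\<close> and the hypothesis on \<open>f\<close> applies to \<open>k\<close>.\<close>
  then have "(\<Sum>i\<in>I. Re (ip G (P i k) k)) = 0"
    unfolding ip_K_eq_sum by (metis Re_sum zero_complex.simps(1))
  then have Pk: "Re (ip G (P i k) k) = 0" if "i \<in> I" for i
    using that finite_I ip_P_nonneg by (subst (asm) sum_nonneg_eq_0_iff) auto
  have "P i k x = 0" if "i \<in> I" "x \<in> G" for i x
  proof -
    have "Re (ip G (P i k) (P i k)) = 0" using Pk[OF that(1)] by (simp add: ip_P_P[OF that(1)])
    then have "ip G (P i k) (P i k) = 0" unfolding ip_self by simp
    then show ?thesis using that finite_G by (simp add: ip_self_eq_0_iff)
  qed
  then have "ip G f k = 0" by (rule f)
  moreover have "ip G (K g) k = 0"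
    unfolding K_selfadjoint using Kk by (simp add: ip_def)
  ultimately have "ip G k k = 0"
    using ip_diff_left[of G f "K g" k] by (simp add: k_def[abs_def])
  then have fK: "f x = K g x" if "x \<in> G" for x
    using that finite_G by (simp add: ip_self_eq_0_iff k_def)
  have "ip G f f = ip G (K g) (K g)" by (rule ip_cong) (auto simp: fK)
  then have 1: "ip G f f = ip G (K (K g)) g" by (simp add: K_selfadjoint)
  have "ip G (K f) f = ip G (K (K g)) (K g)"
    using K_cong[of f "K g"] fK by (intro ip_cong) auto
  then have 2: "ip G (K f) f = ip G (K (K (K g))) g" by (simp add: K_selfadjoint)
  show ?thesis unfolding 1 2 by (rule ip_KKK_ge)
qed

end

section \<open>Matrices over a finite field\<close>

lemma bij_betw_mat:
  "bij_betw (mat m n) (({..<m} \<times> {..<n}) \<rightarrow>\<^sub>E UNIV) (carrier_mat m n)"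
  unfolding bij_betw_def
proof (intro conjI equalityI subsetI inj_onI)
  fix f g :: "nat \<times> nat \<Rightarrow> 'a"
  assume f: "f \<in> ({..<m} \<times> {..<n}) \<rightarrow>\<^sub>E UNIV" and g: "g \<in> ({..<m} \<times> {..<n}) \<rightarrow>\<^sub>E UNIV"
    and eq: "mat m n f = mat m n g"
  show "f = g"
  proof (rule PiE_ext[OF f g], clarsimp)
    fix i j assume "i < m" "j < n"
    then show "f (i, j) = g (i, j)" using arg_cong[OF eq, of "\<lambda>A. A $$ (i, j)"] by simp
  qed
next
  fix A :: "'a mat" assume "A \<in> carrier_mat m n"
  then show "A \<in> mat m n ` (({..<m} \<times> {..<n}) \<rightarrow>\<^sub>E UNIV)"
    by (intro image_eqI[of _ _ "restrict (\<lambda>ij. A $$ ij) ({..<m} \<times> {..<n})"]) (auto intro!: eq_matI)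
qed auto

lemma finite_carrier_mat [simp]: "finite (carrier_mat m n :: 'a::finite mat set)"
  using bij_betw_finite[OF bij_betw_mat[of m n]] by (auto intro: finite_PiE)

lemma card_carrier_mat: "card (carrier_mat m n :: 'a::finite mat set) = CARD('a) ^ (m * n)"
  using bij_betw_same_card[OF bij_betw_mat[where ?'a = 'a, of m n]] by (simp add: card_PiE)

lemma bij_betw_mat_of_col: "bij_betw (\<lambda>v. mat_of_cols n [v]) (carrier_vec n) (carrier_mat n 1)"
proof (rule bij_betw_byWitness[where f' = "\<lambda>A. col A 0"])
  show "\<forall>a'\<in>carrier_mat n 1. mat_of_cols n [col a' 0] = a'"
    by (auto intro!: eq_matI simp: mat_of_cols_def)
qed (auto intro!: eq_vecI simp: mat_of_cols_def)

lemma finite_carrier_vec [simp]: "finite (carrier_vec n :: 'a::finite Matrix.vec set)"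
  using bij_betw_finite[OF bij_betw_mat_of_col[where ?'a = 'a, of n]] by simp

lemma card_carrier_vec: "card (carrier_vec n :: 'a::finite Matrix.vec set) = CARD('a) ^ n"
  using bij_betw_same_card[OF bij_betw_mat_of_col[where ?'a = 'a, of n]] by (simp add: card_carrier_mat)

section \<open>The trace pairing and its character sums\<close>

lemma mat_trace_add:
  "A \<in> carrier_mat n n \<Longrightarrow> B \<in> carrier_mat n n \<Longrightarrow> mat_trace (A + B) = mat_trace A + mat_trace B"
  unfolding mat_trace_def by (simp add: sum.distrib)

lemma mat_trace_uminus: "A \<in> carrier_mat n n \<Longrightarrow> mat_trace (- A) = - mat_trace A"
  unfolding mat_trace_def by (simp add: sum_negf)

lemma mat_trace_comm:
  assumes "A \<in> carrier_mat m n" "B \<in> carrier_mat n m"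
  shows "mat_trace (A * B) = mat_trace (B * A)"
proof -
  have "mat_trace (A * B) = (\<Sum>i<m. \<Sum>j<n. A $$ (i, j) * B $$ (j, i))"
    using assms unfolding mat_trace_def
    by (auto simp: scalar_prod_def atLeast0LessThan intro!: sum.cong)
  also have "\<dots> = (\<Sum>j<n. \<Sum>i<m. B $$ (j, i) * A $$ (i, j))"
    by (subst sum.swap) (simp add: mult.commute)
  also have "\<dots> = mat_trace (B * A)"
    using assms unfolding mat_trace_def
    by (auto simp: scalar_prod_def atLeast0LessThan intro!: sum.cong)
  finally show ?thesis .
qed

lemma exists_mat_trace_mult_eq:
  fixes T :: "'a::finite_field mat"
  assumes T: "T \<in> carrier_mat n d" and "T \<noteq> 0\<^sub>m n d"
  shows "\<exists>Y\<in>carrier_mat d n. mat_trace (Y * T) = a"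
proof -
  obtain i j where ij: "i < n" "j < d" "T $$ (i, j) \<noteq> 0"
    using assms by (metis carrier_matD(1) carrier_matD(2) eq_matI index_zero_mat)
  define Y where "Y = mat d n (\<lambda>(k, l). if k = j \<and> l = i then a / T $$ (i, j) else 0)"
  have "mat_trace (Y * T) = (\<Sum>k<d. \<Sum>l<n. Y $$ (k, l) * T $$ (l, k))"
    using T unfolding mat_trace_def Y_def
    by (auto simp: scalar_prod_def atLeast0LessThan intro!: sum.cong)
  also have "\<dots> = (\<Sum>k<d. \<Sum>l<n. if k = j then (if l = i then a else 0) else 0)"
    using ij by (intro sum.cong refl) (auto simp: Y_def)
  also have "\<dots> = (\<Sum>k<d. if k = j then (\<Sum>l<n. if l = i then a else 0) else 0)"
    by (intro sum.cong refl) auto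
  also have "\<dots> = a" using ij by simp
  finally show ?thesis by (intro bexI[of _ Y]) (auto simp: Y_def)
qed

lemma sum_add_char_mat_trace:
  fixes T :: "'a::finite_field mat"
  assumes T: "T \<in> carrier_mat n d"
  shows "(\<Sum>Y\<in>carrier_mat d n. add_char (mat_trace (Y * T))) =
    (if T = 0\<^sub>m n d then of_nat (CARD('a) ^ (d * n)) else 0)"
proof (cases "T = 0\<^sub>m n d")
  case True
  have "add_char (mat_trace (Y * T)) = 1" if "Y \<in> carrier_mat d n" for Y
    using that by (simp add: True mat_trace_def)
  then show ?thesis using True by (simp add: card_carrier_mat)
next
  case False
  obtain a :: 'a where a: "add_char a \<noteq> 1" using add_char_nontrivial by blast
  obtain Z where Z: "Z \<in> carrier_mat d n" "mat_trace (Z * T) = a"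
    using exists_mat_trace_mult_eq[OF T False] by blast
  let ?S = "\<Sum>Y\<in>carrier_mat d n. add_char (mat_trace (Y * T))"
  \<comment> \<open>Translation by \<open>Z\<close> permutes the matrices but multiplies the sum by
    \<open>add_char a\<close>, which is not 1.\<close>
  have "?S = (\<Sum>Y\<in>carrier_mat d n. add_char (mat_trace ((Y + Z) * T)))"
    by (rule sum.reindex_bij_witness[of _ "\<lambda>Y. Y + Z" "\<lambda>Y. Y - Z"])
      (use Z in \<open>auto intro!: arg_cong[of _ _ add_char] arg_cong[of _ _ mat_trace] arg_cong[of _ _ "\<lambda>u. u * T"] eq_matI\<close>)
  also have "\<dots> = (\<Sum>Y\<in>carrier_mat d n. add_char (mat_trace (Y * T)) * add_char a)"
    using T Z by (intro sum.cong refl)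
      (simp add: add_mult_distrib_mat[of _ d n] mat_trace_add[of _ d] add_char_add)
  also have "\<dots> = add_char a * ?S" by (simp add: sum_distrib_left mult.commute)
  finally have "(1 - add_char a) * ?S = 0" by (simp add: algebra_simps)
  then show ?thesis using a False by simp
qed

section \<open>Rank and factorisations through the echelon form\<close>

lemma wide_mat_kernel:
  fixes Y :: "'a::field mat"
  assumes Y: "Y \<in> carrier_mat d e" and "d < e"
  shows "\<exists>v\<in>carrier_vec e. v \<noteq> 0\<^sub>v e \<and> Y *\<^sub>v v = 0\<^sub>v d"
proof -
  \<comment> \<open>Zero rows make the matrix square; expanding its determinant along row
    \<open>d\<close>, the first added one, gives 0.\<close>
  define A where "A = mat e e (\<lambda>(i, j). if i < d then Y $$ (i, j) else 0)"
  have A: "A \<in> carrier_mat e e" by (simp add: A_def)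
  have "det A = (\<Sum>j<e. A $$ (d, j) * cofactor A d j)"
    using A \<open>d < e\<close> by (rule laplace_expansion_row)
  also have "\<dots> = 0" using \<open>d < e\<close> by (simp add: A_def)
  finally obtain v where v: "v \<in> carrier_vec e" "v \<noteq> 0\<^sub>v e" "A *\<^sub>v v = 0\<^sub>v e"
    using det_0_iff_vec_prod_zero[OF A] by blast
  have "Y *\<^sub>v v = 0\<^sub>v d"
  proof (rule eq_vecI)
    fix i assume "i < dim_vec (0\<^sub>v d :: 'a Matrix.vec)"
    then have i: "i < d" by simp
    have "row A i = row Y i" using i Y \<open>d < e\<close> by (intro eq_vecI) (auto simp: A_def)
    then have "(Y *\<^sub>v v) $ i = (A *\<^sub>v v) $ i" using i Y A \<open>d < e\<close> by simp
    then show "(Y *\<^sub>v v) $ i = 0\<^sub>v d $ i" using v i \<open>d < e\<close> by simp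
  qed (use Y in auto)
  then show ?thesis using v by blast
qed

text \<open>Each column of \<open>B * Y\<close> is \<open>B\<close> applied to a vector with
  \<open>d\<close> entries. More than \<open>d\<close> independent columns would lift to the columns
  of a wide matrix \<open>C\<close>, and a kernel vector of \<open>C\<close> is a linear relation
  among them.\<close>

lemma rank_mult_le:
  fixes B :: "'a::field mat"
  assumes B: "B \<in> carrier_mat n d" and Y: "Y \<in> carrier_mat d n"
  shows "vec_space.rank n (B * Y) \<le> d"
proof -
  interpret vec_space "TYPE('a)" n .
  have BY: "B * Y \<in> carrier_mat n n" using B Y by simp
  obtain S where S: "maximal S (\<lambda>T. T \<subseteq> set (cols (B * Y)) \<and> lin_indpt T)"
    using maximal_exists[of "(\<lambda>T. T \<subseteq> set (cols (B * Y)) \<and> lin_indpt T)" "card (set (cols (B * Y)))" "{}"]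
    by (meson List.finite_set card_mono empty_iff empty_subsetI finite_lin_indpt2 rev_finite_subset)
  have r: "rank (B * Y) = card S" by (rule rank_card_indpt[OF BY S])
  have Ss: "S \<subseteq> set (cols (B * Y))" and li: "lin_indpt S" using S by (auto simp: maximal_def)
  obtain xs where xs: "set xs = S" "distinct xs"
    using finite_distinct_list[OF finite_subset[OF Ss]] by auto
  show ?thesis
  proof (rule ccontr)
    assume "\<not> rank (B * Y) \<le> d"
    then have len: "d < length xs" unfolding r xs(1)[symmetric] distinct_card[OF xs(2)] by simp
    have "\<exists>y. y \<in> carrier_vec d \<and> B *\<^sub>v y = x" if x: "x \<in> S" for x
    proof -
      obtain j where "j < n" "x = col (B * Y) j"
        using x Ss Y unfolding cols_def by auto
      then have "x = B *\<^sub>v col Y j" using B Y by (auto intro!: eq_vecI)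
      then show ?thesis using Y \<open>j < n\<close> by (intro exI[of _ "col Y j"]) auto
    qed
    then obtain y where y: "\<And>x. x \<in> S \<Longrightarrow> y x \<in> carrier_vec d" "\<And>x. x \<in> S \<Longrightarrow> B *\<^sub>v y x = x"
      by metis
    define C where "C = mat_of_cols d (map y xs)"
    have C: "C \<in> carrier_mat d (length xs)" unfolding C_def using mat_of_cols_carrier(1)[of d "map y xs"] by simp
    have xsn: "set xs \<subseteq> carrier_vec n" using xs Ss BY cols_dim[of "B * Y"] by (metis carrier_matD(1) order_trans)
    define D where "D = mat_of_cols n xs"
    have D: "D \<in> carrier_mat n (length xs)" unfolding D_def by (rule mat_of_cols_carrier(1))
    have cD: "cols D = xs" unfolding D_def by (rule cols_mat_of_cols[OF xsn])
    have BC: "B * C = D"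
    proof (rule mat_col_eqI)
      fix j assume "j < dim_col D"
      then have j: "j < length xs" by (simp add: D_def)
      have xj: "xs ! j \<in> S" using j xs by auto
      have "col C j = y (xs ! j)" using j y(1)[OF xj] by (simp add: C_def)
      moreover have "col (B * C) j = B *\<^sub>v col C j" using B C j by (auto intro!: eq_vecI)
      moreover have "col D j = xs ! j" using j xsn by (simp add: D_def subset_iff)
      ultimately show "col (B * C) j = col D j" using y(2)[OF xj] by simp
    qed (use B C D in auto)
    obtain v where v: "v \<in> carrier_vec (length xs)" "v \<noteq> 0\<^sub>v (length xs)" "C *\<^sub>v v = 0\<^sub>v d"
      using wide_mat_kernel[OF C len] by blast
    have "D *\<^sub>v v = B *\<^sub>v (C *\<^sub>v v)" unfolding BC[symmetric] using B C v by simp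
    also have "\<dots> = 0\<^sub>v n" unfolding v(3) using B by (intro eq_vecI) auto
    finally have "lin_dep (set (cols D))" using lin_depI[OF D v(1,2)] xs cD by simp
    then show False using li xs cD by simp
  qed
qed

lemma obtain_echelon:
  fixes Y :: "'a::field mat"
  assumes Y: "Y \<in> carrier_mat d n"
  obtains P Q R f where "P \<in> carrier_mat d d" "Q \<in> carrier_mat d d" "R \<in> carrier_mat d n"
    "Q * P = 1\<^sub>m d" "P * Q = 1\<^sub>m d" "Y = Q * R" "pivot_fun R f n"
proof -
  define R where "R = gauss_jordan_single Y"
  note g = gauss_jordan_single[OF Y R_def[symmetric]]
  obtain P Q where PQ: "R = P * Y" "P \<in> carrier_mat d d" "Q \<in> carrier_mat d d"
    "P * Q = 1\<^sub>m d" "Q * P = 1\<^sub>m d" using g(4) by blast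
  have "Q * R = Q * P * Y" unfolding PQ(1) using PQ(2,3) Y by (simp add: assoc_mult_mat[of _ d d _ d _ n])
  then have YQ: "Y = Q * R" using PQ(5) Y by simp
  obtain f where "pivot_fun R f (dim_col R)" using g(3) unfolding row_echelon_form_def by blast
  then have f: "pivot_fun R f n" using g(2) by simp
  show ?thesis by (rule that[OF PQ(2,3) g(2) PQ(5,4) YQ f])
qed

lemma right_invertible_or_factor:
  fixes Y :: "'a::field mat"
  assumes Y: "Y \<in> carrier_mat d n"
  shows "(\<exists>Z\<in>carrier_mat n d. Y * Z = 1\<^sub>m d) \<or>
    (d > 0 \<and> (\<exists>C\<in>carrier_mat d (d - 1). \<exists>W\<in>carrier_mat (d - 1) n. Y = C * W))"
proof (cases "d = 0")
  case True
  then have "Y * 0\<^sub>m n 0 = 1\<^sub>m 0" using Y by (intro eq_matI) auto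
  then show ?thesis using True by (intro disjI1 bexI[of _ "0\<^sub>m n 0"]) auto
next
  case False
  obtain P Q R f where PQ: "P \<in> carrier_mat d d" "Q \<in> carrier_mat d d" "R \<in> carrier_mat d n"
    "Q * P = 1\<^sub>m d" "P * Q = 1\<^sub>m d" "Y = Q * R" and f: "pivot_fun R f n"
    by (rule obtain_echelon[OF Y])
  have dR: "dim_row R = d" using PQ by simp
  note pv = pivot_funD[OF dR f]
  show ?thesis
  proof (cases "f (d - 1) = n")
    case True
    define C where "C = mat d (d - 1) (\<lambda>(i, j). Q $$ (i, j))"
    define W where "W = mat (d - 1) n (\<lambda>(i, j). R $$ (i, j))"
    have "Y = C * W"
    proof (rule eq_matI)
      fix i j assume "i < dim_row (C * W)" "j < dim_col (C * W)"
      then have ij: "i < d" "j < n" by (auto simp: C_def W_def)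
      have "Y $$ (i, j) = (\<Sum>k<d. Q $$ (i, k) * R $$ (k, j))"
        unfolding PQ(6) using ij PQ by (auto simp: scalar_prod_def atLeast0LessThan)
      also have "\<dots> = (\<Sum>k<Suc (d - 1). Q $$ (i, k) * R $$ (k, j))" using False by simp
      also have "\<dots> = (\<Sum>k<d - 1. Q $$ (i, k) * R $$ (k, j))"
        unfolding sum.lessThan_Suc using pv(2)[of "d - 1" j] True False ij by simp
      also have "\<dots> = (C * W) $$ (i, j)"
        using ij by (auto simp: C_def W_def scalar_prod_def atLeast0LessThan intro!: sum.cong)
      finally show "Y $$ (i, j) = (C * W) $$ (i, j)" .
    qed (use Y in \<open>auto simp: C_def W_def\<close>)
    then show ?thesis using False by (intro disjI2 conjI bexI[of _ C] bexI[of _ W]) (auto simp: C_def W_def)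
  next
    case last: False
    \<comment> \<open>In \<open>pivot_fun\<close> the value \<open>n\<close> marks a zero row, and
      below a zero row all rows are zero, down to the last.\<close>
    have lt: "f i < n" if "i < d" for i
    proof (rule ccontr)
      assume "\<not> f i < n"
      then have "f i = n" using pv(1)[OF that] by simp
      have "f (i + k) = n" if "i + k < d" for k
        using that
      proof (induction k)
        case (Suc k)
        then show ?case using pv(3)[of "i + k"] pv(1)[of "Suc (i + k)"] by auto
      qed (use \<open>f i = n\<close> in simp)
      from this[of "d - 1 - i"] that last show False by simp
    qed
    define Z where "Z = mat n d (\<lambda>(k, i). if k = f i then 1 else (0 :: 'a))"
    have Z: "Z \<in> carrier_mat n d" by (simp add: Z_def)
    have RZ: "R * Z = 1\<^sub>m d"
    proof (rule eq_matI)
      fix i j assume "i < dim_row (1\<^sub>m d :: 'a mat)" "j < dim_col (1\<^sub>m d :: 'a mat)"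
      then have ij: "i < d" "j < d" by auto
      have "(R * Z) $$ (i, j) = (\<Sum>k<n. R $$ (i, k) * Z $$ (k, j))"
        using ij PQ Z by (auto simp: scalar_prod_def atLeast0LessThan)
      also have "\<dots> = (\<Sum>k<n. if k = f j then R $$ (i, f j) else 0)"
        using ij by (intro sum.cong) (auto simp: Z_def)
      also have "\<dots> = R $$ (i, f j)" using lt[OF ij(2)] by simp
      also have "\<dots> = 1\<^sub>m d $$ (i, j)" using pv(4)[OF ij(2) lt[OF ij(2)]] pv(5)[OF ij(2) lt[OF ij(2)] ij(1)] ij by auto
      finally show "(R * Z) $$ (i, j) = 1\<^sub>m d $$ (i, j)" .
    qed (use PQ Z in auto)
    have "Y * (Z * P) = Q * (R * Z) * P"
      unfolding PQ(6) using PQ(1-3) Z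
      by (simp add: assoc_mult_mat[of _ d d _ n _ d] assoc_mult_mat[of _ d n _ d _ d] assoc_mult_mat[of _ d d _ d _ d])
    then have "Y * (Z * P) = 1\<^sub>m d" using RZ PQ by simp
    then show ?thesis using Z PQ by (intro disjI1 bexI[of _ "Z * P"]) auto
  qed
qed

text \<open>The echelon form of \<open>B\<close> vanishes from row \<open>d\<close> on, so it is the
  matrix of the first \<open>d\<close> columns of the identity times a square block
  \<open>C\<close>. This reduces the fibres of \<open>g -> g * B\<close> for arbitrary
  \<open>B\<close> to those of left invertible matrices.\<close>

lemma factor_left_invertible:
  fixes B :: "'a::field mat"
  assumes B: "B \<in> carrier_mat n d" and "d \<le> n"
  shows "\<exists>B'\<in>carrier_mat n d. \<exists>C\<in>carrier_mat d d. \<exists>L\<in>carrier_mat d n. B = B' * C \<and> L * B' = 1\<^sub>m d"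
proof -
  obtain P Q R f where PQ: "P \<in> carrier_mat n n" "Q \<in> carrier_mat n n" "R \<in> carrier_mat n d"
    "Q * P = 1\<^sub>m n" "P * Q = 1\<^sub>m n" "B = Q * R" and f: "pivot_fun R f d"
    by (rule obtain_echelon[OF B])
  have dR: "dim_row R = n" using PQ by simp
  note pv = pivot_funD[OF dR f]
  have zero: "R $$ (i, j) = 0" if "d \<le> i" "i < n" "j < d" for i j
  proof -
    \<comment> \<open>A pivot of row \<open>i\<close> lies in column \<open>i\<close> or later,
      which leaves no room among \<open>d\<close> columns once \<open>d \<le> i\<close>.\<close>
    have "f i = d \<or> f i \<ge> i" using pivot_bound[OF dR f, of 0 i] that by auto
    then have "f i = d" using pv(1)[of i] that by auto
    then show ?thesis using pv(2)[of i j] that by auto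
  qed
  define E where "E = mat n d (\<lambda>(i, j). if i = j then 1 else (0 :: 'a))"
  define F where "F = mat d n (\<lambda>(i, j). if i = j then 1 else (0 :: 'a))"
  define C where "C = mat d d (\<lambda>(i, j). R $$ (i, j))"
  have EFC: "E \<in> carrier_mat n d" "F \<in> carrier_mat d n" "C \<in> carrier_mat d d"
    by (auto simp: E_def F_def C_def)
  have R: "R = E * C"
  proof (rule eq_matI)
    fix i j assume "i < dim_row (E * C)" "j < dim_col (E * C)"
    then have ij: "i < n" "j < d" using EFC by auto
    have "(E * C) $$ (i, j) = (\<Sum>k<d. E $$ (i, k) * C $$ (k, j))"
      using ij EFC by (auto simp: scalar_prod_def atLeast0LessThan)
    also have "\<dots> = (\<Sum>k<d. if k = i then R $$ (i, j) else 0)"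
      using ij by (intro sum.cong) (auto simp: E_def C_def)
    finally show "R $$ (i, j) = (E * C) $$ (i, j)" using zero ij by (cases "i < d") auto
  qed (use EFC PQ in auto)
  have FE: "F * E = 1\<^sub>m d"
  proof (rule eq_matI)
    fix i j assume "i < dim_row (1\<^sub>m d :: 'a mat)" "j < dim_col (1\<^sub>m d :: 'a mat)"
    then have ij: "i < d" "j < d" by auto
    have "(F * E) $$ (i, j) = (\<Sum>k<n. F $$ (i, k) * E $$ (k, j))"
      using ij EFC by (auto simp: scalar_prod_def atLeast0LessThan)
    also have "\<dots> = (\<Sum>k<n. if k = i then (if i = j then 1 else 0) else 0)"
      using ij by (intro sum.cong) (auto simp: E_def F_def)
    finally show "(F * E) $$ (i, j) = 1\<^sub>m d $$ (i, j)" using ij \<open>d \<le> n\<close> by simp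
  qed (use EFC in auto)
  have "B = (Q * E) * C" unfolding PQ(6) R using PQ EFC by (simp add: assoc_mult_mat[of _ n n _ d _ d])
  moreover have "(F * P) * (Q * E) = F * ((P * Q) * E)"
    using PQ(1-3) EFC by (simp add: assoc_mult_mat[of _ d n _ n _ d] assoc_mult_mat[of _ n n _ n _ d])
  then have "(F * P) * (Q * E) = 1\<^sub>m d" using PQ EFC FE by simp
  ultimately show ?thesis using PQ EFC
    by (intro bexI[of _ "Q * E"] bexI[of _ C] bexI[of _ "F * P"]) auto
qed

section \<open>The order of the special linear group\<close>

text \<open>The determinant is a linear form in the new column, with cofactors of \<open>A\<close>
  as coefficients; matrices of determinant 1 are counted through this form.\<close>

definition subst_col :: "nat \<Rightarrow> 'a mat \<Rightarrow> 'a Matrix.vec \<Rightarrow> 'a mat" where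
  "subst_col k A r = mat (dim_row A) (dim_col A) (\<lambda>(i, j). if j = k then r $ i else A $$ (i, j))"

lemma subst_col_carrier [simp]:
  "A \<in> carrier_mat m n \<Longrightarrow> subst_col k A r \<in> carrier_mat m n"
  by (auto simp: subst_col_def)

lemma det_subst_col:
  fixes A :: "'a::comm_ring_1 mat"
  assumes A: "A \<in> carrier_mat n n" and k: "k < n"
  shows "det (subst_col k A r) = (\<Sum>i<n. r $ i * cofactor A i k)"
proof -
  have "mat_delete (subst_col k A r) i k = mat_delete A i k" if "i < n" for i
    using A k that by (intro eq_matI) (auto simp: mat_delete_def subst_col_def)
  then have "cofactor (subst_col k A r) i k = cofactor A i k" if "i < n" for i
    using that by (simp add: cofactor_def)
  then show ?thesis
    using A k laplace_expansion_column[OF subst_col_carrier[OF A] k, of k r]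
    by (simp add: subst_col_def)
qed

lemma subst_col_mult_vec:
  fixes A :: "'a::comm_ring_1 mat"
  assumes A: "A \<in> carrier_mat m n" and k: "k < n" and v: "v \<in> carrier_vec n" and i: "i < m"
  shows "(subst_col k A r *\<^sub>v v) $ i = (A *\<^sub>v v) $ i + (r $ i - A $$ (i, k)) * v $ k"
proof -
  have "(subst_col k A r *\<^sub>v v) $ i = (\<Sum>j<n. subst_col k A r $$ (i, j) * v $ j)"
    using A v i by (auto simp: subst_col_def scalar_prod_def atLeast0LessThan)
  also have "\<dots> = (\<Sum>j<n. A $$ (i, j) * v $ j + (if j = k then (r $ i - A $$ (i, k)) * v $ k else 0))"
    using A i by (intro sum.cong) (auto simp: subst_col_def algebra_simps)
  also have "\<dots> = (A *\<^sub>v v) $ i + (r $ i - A $$ (i, k)) * v $ k"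
    using A v i k by (simp add: sum.distrib scalar_prod_def atLeast0LessThan)
  finally show ?thesis .
qed

text \<open>Otherwise every vector would be a combination of the last \<open>n - 1\<close> columns of \<open>A\<close>.\<close>

lemma det_subst_col_nonzero:
  fixes A :: "'a::finite_field mat"
  assumes A: "A \<in> carrier_mat n n" and n: "0 < n"
    and indep: "\<And>w. w \<in> carrier_vec n \<Longrightarrow> w $ 0 = 0 \<Longrightarrow> A *\<^sub>v w = 0\<^sub>v n \<Longrightarrow> w = 0\<^sub>v n"
  shows "\<exists>r\<in>carrier_vec n. det (subst_col 0 A r) \<noteq> 0"
proof (rule ccontr)
  assume "\<not> ?thesis"
  then have det0: "\<And>r. r \<in> carrier_vec n \<Longrightarrow> det (subst_col 0 A r) = 0" by blast
  \<comment> \<open>Kernel vectors scaled to first coordinate 1. Such a vector expresses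
    \<open>r\<close> through the other columns and so determines \<open>r\<close>; yet
    \<open>V\<close> has fewer elements than there are vectors \<open>r\<close>.\<close>
  define V where "V = {v \<in> carrier_vec n. v $ 0 = (1 :: 'a)}"
  have "\<exists>v\<in>V. subst_col 0 A r *\<^sub>v v = 0\<^sub>v n" if r: "r \<in> carrier_vec n" for r
  proof -
    have C: "subst_col 0 A r \<in> carrier_mat n n" using A by simp
    obtain v where v: "v \<in> carrier_vec n" "v \<noteq> 0\<^sub>v n" "subst_col 0 A r *\<^sub>v v = 0\<^sub>v n"
      using det0[OF r] det_0_iff_vec_prod_zero[OF C] by blast
    have "v $ 0 \<noteq> 0"
    proof
      assume v0: "v $ 0 = 0"
      have "A *\<^sub>v v = 0\<^sub>v n"
      proof (rule eq_vecI)
        fix i assume "i < dim_vec (0\<^sub>v n :: 'a Matrix.vec)"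
        then have i: "i < n" by simp
        show "(A *\<^sub>v v) $ i = 0\<^sub>v n $ i"
          using subst_col_mult_vec[OF A n v(1) i, of r] v0 v(3) by simp
      qed (use A in auto)
      then show False using indep[OF v(1) v0] v(2) by blast
    qed
    then show ?thesis
      using v C n by (intro bexI[of _ "inverse (v $ 0) \<cdot>\<^sub>v v"])
        (auto simp: V_def mult_mat_vec[of _ n n])
  qed
  then obtain g where g: "\<And>r. r \<in> carrier_vec n \<Longrightarrow> g r \<in> V"
    "\<And>r. r \<in> carrier_vec n \<Longrightarrow> subst_col 0 A r *\<^sub>v g r = 0\<^sub>v n" by metis
  have inj: "inj_on g (carrier_vec n)"
  proof (rule inj_onI)
    fix r s assume rs: "r \<in> carrier_vec n" "s \<in> carrier_vec n" "g r = g s"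
    show "r = s"
    proof (rule eq_vecI)
      fix i assume "i < dim_vec s"
      then have i: "i < n" using rs by simp
      have gV: "g r \<in> carrier_vec n" "g r $ 0 = 1" "g s \<in> carrier_vec n" "g s $ 0 = 1"
        using g(1) rs unfolding V_def by blast+
      have "(A *\<^sub>v g s) $ i + (r $ i - A $$ (i, 0)) = (A *\<^sub>v g s) $ i + (s $ i - A $$ (i, 0))"
        using subst_col_mult_vec[OF A n gV(1) i, of r] subst_col_mult_vec[OF A n gV(3) i, of s]
          g(2)[OF rs(1)] g(2)[OF rs(2)] i gV rs(3) by simp
      then show "r $ i = s $ i" by simp
    qed (use rs in auto)
  qed
  have "0\<^sub>v n \<notin> V" using n by (auto simp: V_def)
  moreover have Vs: "V \<subseteq> carrier_vec n" unfolding V_def by blast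
  ultimately have "V \<subset> carrier_vec n" using zero_carrier_vec[of n] by (metis psubsetI)
  then have "card V < card (carrier_vec n :: 'a Matrix.vec set)" by (intro psubset_card_mono) auto
  moreover have "card (g ` carrier_vec n) \<le> card V"
    using g(1) by (intro card_mono finite_subset[OF Vs finite_carrier_vec]) blast
  ultimately show False using card_image[OF inj] by simp
qed

text \<open>Sliding \<open>r\<close> along a vector \<open>t\<close> on which the form is 1 moves it
  onto the affine hyperplane; remembering the old value of the form makes this injective.\<close>

lemma card_linear_form_eq_1:
  fixes c :: "nat \<Rightarrow> 'a::finite_field"
  assumes s: "s \<in> carrier_vec n" "(\<Sum>i<n. s $ i * c i) \<noteq> 0"
  shows "CARD('a) ^ n \<le> CARD('a) * card {r \<in> carrier_vec n. (\<Sum>i<n. r $ i * c i) = 1}"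
proof -
  define l where "l r = (\<Sum>i<n. r $ i * c i)" for r
  define t where "t = inverse (l s) \<cdot>\<^sub>v s"
  have t: "t \<in> carrier_vec n" "l t = 1"
    using s by (auto simp: t_def l_def mult.assoc sum_distrib_left[symmetric])
  define F where "F r = (l r, r - (l r - 1) \<cdot>\<^sub>v t)" for r
  have "inj_on F (carrier_vec n)"
  proof (rule inj_onI)
    fix r r' assume r: "r \<in> carrier_vec n" "r' \<in> carrier_vec n" "F r = F r'"
    then have "l r = l r'" and eq: "r - (l r - 1) \<cdot>\<^sub>v t = r' - (l r - 1) \<cdot>\<^sub>v t" by (auto simp: F_def)
    show "r = r'"
    proof (rule eq_vecI)
      fix i assume "i < dim_vec r'"
      then show "r $ i = r' $ i" using arg_cong[OF eq, of "\<lambda>v. v $ i"] r t by simp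
    qed (use r in auto)
  qed
  moreover have "F ` carrier_vec n \<subseteq> UNIV \<times> {r \<in> carrier_vec n. l r = 1}"
  proof (clarsimp simp: F_def, intro conjI)
    fix r :: "'a Matrix.vec" assume r: "r \<in> carrier_vec n"
    have "l (r - (l r - 1) \<cdot>\<^sub>v t) = l r - (l r - 1) * l t"
      unfolding l_def using r t by (simp add: algebra_simps sum_subtractf sum.distrib sum_distrib_left)
    then show "l (r - (l r - 1) \<cdot>\<^sub>v t) = 1" using t by simp
    show "r - (l r - 1) \<cdot>\<^sub>v t \<in> carrier_vec n" using r t by simp
  qed
  moreover have "finite {r \<in> carrier_vec n. l r = 1}"
    by (rule finite_subset[OF _ finite_carrier_vec[of n]]) auto
  ultimately have "card (carrier_vec n :: 'a Matrix.vec set) \<le> card (UNIV \<times> {r \<in> carrier_vec n. l r = 1} :: ('a \<times> _) set)"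
    by (intro card_inj_on_le) (auto intro!: finite_cartesian_product)
  then show ?thesis by (simp add: card_carrier_vec card_cartesian_product l_def)
qed

lemma finite_SL [simp]: "finite (SL n)"
  by (rule finite_subset[OF _ finite_carrier_mat[of n n]]) (auto simp: SL_def)

lemma card_zero_first_coord:
  "0 < n \<Longrightarrow> CARD('a) * card {w \<in> carrier_vec n. w $ 0 = (0::'a::finite_field)} \<le> CARD('a) ^ n"
proof -
  assume n: "0 < n"
  let ?W = "{w \<in> carrier_vec n. w $ 0 = (0::'a)}"
  define F where "F = (\<lambda>(x, w). w + x \<cdot>\<^sub>v unit_vec n 0 :: 'a Matrix.vec)"
  have F0: "F (x, w) $ 0 = x" if "w \<in> ?W" for x w using that n by (simp add: F_def)
  have "inj_on F (UNIV \<times> ?W)"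
  proof (rule inj_onI, clarsimp)
    fix x w x' w' assume w: "w \<in> carrier_vec n" "w $ 0 = 0" "w' \<in> carrier_vec n" "w' $ 0 = 0"
      and eq: "F (x, w) = F (x', w')"
    have x: "x = x'" using F0[of w x] F0[of w' x'] w eq by simp
    have "w = w'"
    proof (rule eq_vecI)
      fix i assume "i < dim_vec w'"
      then show "w $ i = w' $ i" using arg_cong[OF eq, of "\<lambda>v. v $ i"] w x by (simp add: F_def)
    qed (use w in auto)
    then show "x = x' \<and> w = w'" using x by simp
  qed
  moreover have "F ` (UNIV \<times> ?W) \<subseteq> carrier_vec n" by (auto simp: F_def)
  ultimately have "card ((UNIV :: 'a set) \<times> ?W) \<le> card (carrier_vec n :: 'a Matrix.vec set)"
    by (intro card_inj_on_le) auto
  then show ?thesis by (simp add: card_carrier_vec card_cartesian_product)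
qed

text \<open>A bad \<open>A\<close>, a scalar \<open>c \<noteq> 0\<close> and a vector
  \<open>r\<close> are encoded by the kernel vector \<open>v = c \<cdot>\<^sub>v w A\<close> and the
  matrix \<open>A\<close> with \<open>r\<close> added to a column at which \<open>v\<close> is
  nonzero. That matrix maps \<open>v\<close> to a nonzero multiple of \<open>r\<close>, so
  \<open>r\<close>, then \<open>A\<close>, then \<open>c\<close> can be recovered. Comparing
  \<open>card Bad * (q - 1) * q^n\<close> with \<open>q^(n - 1) * q^(n * n)\<close> bounds the
  proportion of bad matrices by \<open>1 / (q * (q - 1)) \<le> 1 / 2\<close>.\<close>

lemma card_dependent_cols:
  assumes n: "0 < n"
  shows "2 * card {A \<in> carrier_mat n n. \<exists>w\<in>carrier_vec n. w \<noteq> 0\<^sub>v n \<and> w $ 0 = 0 \<and>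
    A *\<^sub>v w = (0\<^sub>v n :: 'a::finite_field Matrix.vec)} \<le> CARD('a) ^ (n * n)"
proof -
  define Bad where "Bad = {A \<in> carrier_mat n n. \<exists>w\<in>carrier_vec n. w \<noteq> 0\<^sub>v n \<and> w $ 0 = 0 \<and>
    A *\<^sub>v w = (0\<^sub>v n :: 'a Matrix.vec)}"
  let ?W = "{w \<in> carrier_vec n. w $ 0 = (0::'a)}"
  let ?q = "CARD('a)"
  have finW: "finite ?W" by (rule finite_subset[OF _ finite_carrier_vec[of n]]) auto
  have "\<exists>w. \<forall>A\<in>Bad. w A \<in> ?W \<and> w A \<noteq> 0\<^sub>v n \<and> A *\<^sub>v w A = 0\<^sub>v n"
    by (rule bchoice) (auto simp: Bad_def)
  then obtain w where w: "\<And>A. A \<in> Bad \<Longrightarrow> w A \<in> ?W \<and> w A \<noteq> 0\<^sub>v n \<and> A *\<^sub>v w A = 0\<^sub>v n" by blast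
  \<comment> \<open>The column index depends on \<open>v\<close> alone, since decoding must know it
    before it knows \<open>A\<close>.\<close>
  have "\<exists>k. \<forall>v\<in>?W - {0\<^sub>v n}. k v < n \<and> v $ k v \<noteq> 0"
  proof (rule bchoice, rule ballI)
    fix v assume "v \<in> ?W - {0\<^sub>v n}"
    then have "v \<in> carrier_vec n" "v \<noteq> 0\<^sub>v n" by auto
    then show "\<exists>i. i < n \<and> v $ i \<noteq> 0"
      by (metis carrier_vecD eq_vecI index_zero_vec(1) index_zero_vec(2))
  qed
  then obtain k where k: "\<And>v. v \<in> ?W \<Longrightarrow> v \<noteq> 0\<^sub>v n \<Longrightarrow> k v < n \<and> v $ k v \<noteq> 0" by blast
  define F where "F = (\<lambda>(A, c, r). (c \<cdot>\<^sub>v w A, subst_col (k (c \<cdot>\<^sub>v w A)) A (col A (k (c \<cdot>\<^sub>v w A)) + r)))"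
  let ?D = "Bad \<times> (UNIV - {0 :: 'a}) \<times> (carrier_vec n :: 'a Matrix.vec set)"
  have cw: "c \<cdot>\<^sub>v w A \<in> ?W" "c \<cdot>\<^sub>v w A \<noteq> 0\<^sub>v n" "A *\<^sub>v (c \<cdot>\<^sub>v w A) = 0\<^sub>v n" "A \<in> carrier_mat n n"
    if A: "A \<in> Bad" "c \<noteq> 0" for A c
  proof -
    note wA = w[OF A(1)]
    show Ac: "A \<in> carrier_mat n n" using A by (simp add: Bad_def)
    show "c \<cdot>\<^sub>v w A \<in> ?W" using wA n by auto
    have "A *\<^sub>v (c \<cdot>\<^sub>v w A) = c \<cdot>\<^sub>v (A *\<^sub>v w A)" using wA Ac by (auto simp: mult_mat_vec[of _ n n])
    then show "A *\<^sub>v (c \<cdot>\<^sub>v w A) = 0\<^sub>v n" using wA by auto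
    show "c \<cdot>\<^sub>v w A \<noteq> 0\<^sub>v n"
    proof
      assume "c \<cdot>\<^sub>v w A = 0\<^sub>v n"
      then have "inverse c \<cdot>\<^sub>v (c \<cdot>\<^sub>v w A) = 0\<^sub>v n" by (intro eq_vecI) auto
      then show False using A wA by (simp add: smult_smult_assoc)
    qed
  qed
  have inj: "inj_on F ?D"
  proof (rule inj_onI)
    fix x x' assume D: "x \<in> ?D" "x' \<in> ?D" and Fx: "F x = F x'"
    obtain A c r A' c' r' where x: "x = (A, c, r)" "x' = (A', c', r')" by (cases x, cases x')
    have A: "A \<in> Bad" "c \<noteq> 0" "A' \<in> Bad" "c' \<noteq> 0" and r: "r \<in> carrier_vec n" "r' \<in> carrier_vec n"
      using D unfolding x by auto
    have eq: "F (A, c, r) = F (A', c', r')" using Fx unfolding x .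
    define v where "v = c \<cdot>\<^sub>v w A"
    have v': "c' \<cdot>\<^sub>v w A' = v" using eq by (simp add: F_def v_def)
    note c1 = cw[OF A(1,2), folded v_def] and c2 = cw[OF A(3,4), unfolded v']
    have kv: "k v < n" "v $ k v \<noteq> 0" using k[OF c1(1,2)] by auto
    have vc: "v \<in> carrier_vec n" using c1 by simp
    have S: "subst_col (k v) A (col A (k v) + r) = subst_col (k v) A' (col A' (k v) + r')"
      using eq by (simp add: F_def v_def[symmetric] v')
    have ri: "r $ i = r' $ i" if i: "i < n" for i
    proof -
      have "r $ i * v $ k v = r' $ i * v $ k v"
        using subst_col_mult_vec[OF c1(4) kv(1) vc i, of "col A (k v) + r"]
          subst_col_mult_vec[OF c2(4) kv(1) vc i, of "col A' (k v) + r'"] S c1 c2 i r kv by simp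
      then show ?thesis using kv by simp
    qed
    have rr: "r = r'" using r ri by (intro eq_vecI) auto
    have AA: "A = A'"
    proof (rule eq_matI)
      fix i j assume "i < dim_row A'" "j < dim_col A'"
      then have ij: "i < n" "j < n" using c2 by auto
      have "subst_col (k v) A (col A (k v) + r) $$ (i, j) = subst_col (k v) A' (col A' (k v) + r') $$ (i, j)"
        using S by simp
      then show "A $$ (i, j) = A' $$ (i, j)"
        using ij c1(4) c2(4) kv(1) rr r by (auto simp: subst_col_def split: if_splits)
    qed (use c1 c2 in auto)
    obtain i where i: "i < n" "w A $ i \<noteq> 0"
      using k[of "w A"] w[OF A(1)] by blast
    have "c * w A $ i = c' * w A $ i"
      using v' i c1(4) w[OF A(1)] unfolding v_def AA by (auto simp: vec_eq_iff) 
    then have "c = c'" using i by simp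
    then show "x = x'" using AA rr x by simp
  qed
  have img: "F ` ?D \<subseteq> ?W \<times> carrier_mat n n"
  proof (rule image_subsetI)
    fix x assume "x \<in> ?D"
    then obtain A c r where x: "x = (A, c, r)" "A \<in> Bad" "c \<noteq> 0" by auto
    show "F x \<in> ?W \<times> carrier_mat n n"
      using cw(1,4)[OF x(2,3)] unfolding F_def x(1) by auto
  qed
  have "card ?D \<le> card (?W \<times> (carrier_mat n n :: 'a mat set))"
    by (rule card_inj_on_le[OF inj img]) (simp add: finW)
  then have le: "card Bad * ((?q - 1) * ?q ^ n) \<le> card ?W * ?q ^ (n * n)"
    by (simp add: card_cartesian_product card_carrier_vec card_carrier_mat card_Diff_singleton)
  have q2: "2 \<le> ?q"
    using card_mono[of UNIV "{0, 1 :: 'a}"] by simp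
  have "?q ^ n * (card Bad * (?q * (?q - 1))) = ?q * (card Bad * ((?q - 1) * ?q ^ n))" by simp
  also have "\<dots> \<le> ?q * (card ?W * ?q ^ (n * n))" using le by (rule mult_le_mono2)
  also have "\<dots> \<le> ?q ^ n * ?q ^ (n * n)"
    using card_zero_first_coord[OF n, where ?'a = 'a] by (metis mult.assoc mult_le_mono1)
  finally have "card Bad * (?q * (?q - 1)) \<le> ?q ^ (n * n)" using q2 by simp
  moreover have "2 * 1 \<le> ?q * (?q - 1)" using q2 by (intro mult_le_mono) auto
  then have "card Bad * 2 \<le> card Bad * (?q * (?q - 1))" by (intro mult_le_mono2) simp
  ultimately show ?thesis unfolding Bad_def[symmetric] by linarith
qed

text \<open>
  At least half of all matrices have independent columns after the first; for each of these one in
  \<open>CARD('a)\<close> choices of the first column gives determinant 1.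
\<close>

lemma card_SL_ge:
  "CARD('a::finite_field) ^ (n * n) \<le> 2 * CARD('a) * card (SL n :: 'a mat set)"
proof (cases "n = 0")
  case True
  have "1\<^sub>m 0 \<in> (SL 0 :: 'a mat set)" by (simp add: SL_def)
  then have "0 < card (SL 0 :: 'a mat set)" using finite_SL card_gt_0_iff by blast
  moreover have "0 < CARD('a)" by simp
  ultimately have "1 \<le> CARD('a) * card (SL 0 :: 'a mat set)" by (simp add: Suc_le_eq)
  then show ?thesis using True by simp
next
  case False
  then have n: "0 < n" by simp
  let ?q = "CARD('a)"
  define Good where "Good = {A \<in> carrier_mat n n. \<not> (\<exists>w\<in>carrier_vec n. w \<noteq> 0\<^sub>v n \<and> w $ 0 = 0 \<and>
    A *\<^sub>v w = (0\<^sub>v n :: 'a Matrix.vec))}"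
  define Bad where "Bad = {A \<in> carrier_mat n n. \<exists>w\<in>carrier_vec n. w \<noteq> 0\<^sub>v n \<and> w $ 0 = 0 \<and>
    A *\<^sub>v w = (0\<^sub>v n :: 'a Matrix.vec)}"
  have GB: "Good \<union> Bad = carrier_mat n n" "Good \<inter> Bad = {}" by (auto simp: Good_def Bad_def)
  have fin: "finite Good" "finite Bad"
    using finite_carrier_mat[of n n, where ?'a = 'a] finite_subset GB(1) by (metis Un_upper1, metis Un_upper2)
  have "card Good + card Bad = ?q ^ (n * n)"
    using card_Un_disjoint[OF fin GB(2)] GB(1) by (simp add: card_carrier_mat)
  moreover have "2 * card Bad \<le> ?q ^ (n * n)" unfolding Bad_def by (rule card_dependent_cols[OF n])
  ultimately have half: "?q ^ (n * n) \<le> 2 * card Good" by linarith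
  define T where "T A = {r \<in> carrier_vec n. det (subst_col 0 A r) = 1}" for A :: "'a mat"
  have finT: "finite (T A)" for A
    by (rule finite_subset[OF _ finite_carrier_vec[of n]]) (auto simp: T_def)
  have T: "?q ^ n \<le> ?q * card (T A)" if A: "A \<in> Good" for A
  proof -
    have Ac: "A \<in> carrier_mat n n" using A by (simp add: Good_def)
    obtain s where s: "s \<in> carrier_vec n" "det (subst_col 0 A s) \<noteq> 0"
      using det_subst_col_nonzero[OF Ac n] A unfolding Good_def by blast
    show ?thesis
      using card_linear_form_eq_1[OF s(1), of "\<lambda>i. cofactor A i 0"] s(2)
      unfolding T_def det_subst_col[OF Ac n] by simp
  qed
  \<comment> \<open>Recording the old first column restores what the substitution forgets; it costs
    a factor \<open>q^n\<close>, which cancels against the \<open>q^n\<close> in the bound on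
    \<open>card (T A)\<close>.\<close>
  have inj: "inj_on (\<lambda>(A, r). (subst_col 0 A r, col A 0)) (Sigma Good T)"
  proof (rule inj_onI, clarify)
    fix A r A' r'
    assume A: "A \<in> Good" "A' \<in> Good" "r \<in> T A" "r' \<in> T A'"
      and S: "subst_col 0 A r = subst_col 0 A' r'" and c: "col A 0 = col A' 0"
    have Ac: "A \<in> carrier_mat n n" "A' \<in> carrier_mat n n" using A by (auto simp: Good_def)
    have S': "subst_col 0 A r $$ (i, j) = subst_col 0 A' r' $$ (i, j)" for i j using S by simp
    have "A = A'"
    proof (rule eq_matI)
      fix i j assume "i < dim_row A'" "j < dim_col A'"
      then show "A $$ (i, j) = A' $$ (i, j)"
        using S'[of i j] arg_cong[OF c, of "\<lambda>v. v $ i"] Ac n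
        by (cases "j = 0") (auto simp: subst_col_def)
    qed (use Ac in auto)
    moreover have "r = r'"
    proof (rule eq_vecI)
      fix i assume "i < dim_vec r'"
      then show "r $ i = r' $ i" using S'[of i 0] Ac n A by (auto simp: subst_col_def T_def)
    qed (use A in \<open>auto simp: T_def\<close>)
    ultimately show "A = A' \<and> r = r'" by simp
  qed
  have img: "(\<lambda>(A, r). (subst_col 0 A r, col A 0)) ` Sigma Good T \<subseteq> SL n \<times> carrier_vec n"
    by (auto simp: Good_def T_def SL_def)
  have "card (Sigma Good T) \<le> card ((SL n :: 'a mat set) \<times> (carrier_vec n :: 'a Matrix.vec set))"
    by (rule card_inj_on_le[OF inj img]) simp
  then have le: "(\<Sum>A\<in>Good. card (T A)) \<le> card (SL n :: 'a mat set) * ?q ^ n"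
    using fin finT by (simp add: card_cartesian_product card_carrier_vec)
  have "card Good * ?q ^ n = (\<Sum>A\<in>Good. ?q ^ n)" by simp
  also have "\<dots> \<le> (\<Sum>A\<in>Good. ?q * card (T A))" by (intro sum_mono T)
  also have "\<dots> \<le> ?q * card (SL n :: 'a mat set) * ?q ^ n"
    unfolding sum_distrib_left[symmetric] mult.assoc using le by (rule mult_le_mono2)
  finally have "card Good \<le> ?q * card (SL n :: 'a mat set)" by simp
  then show ?thesis using half by linarith
qed

section \<open>Fibres of the special linear group\<close>

abbreviation SL_inv :: "'a::finite_field mat \<Rightarrow> 'a mat" where
  "SL_inv g \<equiv> the (mat_inverse g)"

lemma SL_carrier: "g \<in> SL n \<Longrightarrow> g \<in> carrier_mat n n"
  by (simp add: SL_def)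

lemma SL_inv:
  assumes g: "g \<in> SL n"
  shows "SL_inv g \<in> SL n" "SL_inv g * g = 1\<^sub>m n" "g * SL_inv g = 1\<^sub>m n"
proof -
  have gc: "g \<in> carrier_mat n n" and d: "det g = 1" using g by (auto simp: SL_def)
  have "g \<in> Units (ring_mat TYPE('a) n undefined)" using det_non_zero_imp_unit[OF gc] d by simp
  then obtain h where h: "mat_inverse g = Some h"
    using mat_inverse(1)[OF gc] by (metis not_None_eq)
  have i: "g * h = 1\<^sub>m n" "h * g = 1\<^sub>m n" "h \<in> carrier_mat n n"
    using mat_inverse(2)[OF gc h] by auto
  have "det h = 1" using det_mult[OF gc i(3)] i(1) d by simp
  then show "SL_inv g \<in> SL n" "SL_inv g * g = 1\<^sub>m n" "g * SL_inv g = 1\<^sub>m n"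
    using i h by (auto simp: SL_def)
qed

lemma SL_mult: "g \<in> SL n \<Longrightarrow> h \<in> SL n \<Longrightarrow> g * h \<in> SL n"
  by (auto simp: SL_def det_mult)

lemma SL_mult_assoc:
  "g \<in> SL n \<Longrightarrow> h \<in> SL n \<Longrightarrow> B \<in> carrier_mat n d \<Longrightarrow> (g * h) * B = g * (h * B)"
  using assoc_mult_mat[of g n n h n B d] by (simp add: SL_carrier)

lemma SL_inv_cancel:
  assumes "g \<in> SL n" "B \<in> carrier_mat n d"
  shows "SL_inv g * (g * B) = B" "g * (SL_inv g * B) = B"
  using assms SL_inv[OF assms(1)] by (simp_all flip: SL_mult_assoc)

lemma SL_inv_unique:
  assumes "g \<in> SL n" "h \<in> SL n" "h * g = 1\<^sub>m n"
  shows "SL_inv g = h"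
proof -
  have "SL_inv g = (h * g) * SL_inv g" using assms(3) SL_carrier[OF SL_inv(1)[OF assms(1)]] by simp
  also have "\<dots> = h * (g * SL_inv g)" by (rule SL_mult_assoc[OF assms(2,1) SL_carrier[OF SL_inv(1)[OF assms(1)]]])
  also have "\<dots> = h" using assms SL_inv[OF assms(1)] SL_carrier[OF assms(2)] by simp
  finally show ?thesis .
qed

lemma one_SL: "1\<^sub>m n \<in> SL n"
  by (simp add: SL_def)

section \<open>Matrices standing for subspaces with a basis\<close>

definition left_invertible :: "nat \<Rightarrow> nat \<Rightarrow> 'a::finite_field mat set" where
  "left_invertible n d = {B \<in> carrier_mat n d. \<exists>L\<in>carrier_mat d n. L * B = 1\<^sub>m d}"

definition GL :: "nat \<Rightarrow> 'a::finite_field mat set" where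
  "GL d = {M \<in> carrier_mat d d. \<exists>N\<in>carrier_mat d d. M * N = 1\<^sub>m d \<and> N * M = 1\<^sub>m d}"

lemma finite_left_invertible: "finite (left_invertible n d)"
  by (rule finite_subset[OF _ finite_carrier_mat[of n d]]) (auto simp: left_invertible_def)

lemma finite_GL: "finite (GL d)"
  by (rule finite_subset[OF _ finite_carrier_mat[of d d]]) (auto simp: GL_def)

lemma left_invertible_SL_mult:
  assumes B: "B \<in> left_invertible n d" and g: "g \<in> SL n"
  shows "g * B \<in> left_invertible n d"
proof -
  obtain L where L: "B \<in> carrier_mat n d" "L \<in> carrier_mat d n" "L * B = 1\<^sub>m d"
    using B by (auto simp: left_invertible_def)
  have "(L * SL_inv g) * (g * B) = L * (SL_inv g * (g * B))"
    using L SL_carrier[OF g] SL_carrier[OF SL_inv(1)[OF g]]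
    by (intro assoc_mult_mat[of _ d n _ n _ d]) auto
  then show ?thesis
    using L SL_carrier[OF g] SL_carrier[OF SL_inv(1)[OF g]] SL_inv_cancel(1)[OF g L(1)]
    unfolding left_invertible_def by (intro CollectI conjI bexI[of _ "L * SL_inv g"]) auto
qed

lemma left_invertible_GL_mult:
  assumes B: "B \<in> left_invertible n d" and M: "M \<in> GL d"
  shows "B * M \<in> left_invertible n d"
proof -
  obtain L where L: "B \<in> carrier_mat n d" "L \<in> carrier_mat d n" "L * B = 1\<^sub>m d"
    using B by (auto simp: left_invertible_def)
  obtain N where N: "M \<in> carrier_mat d d" "N \<in> carrier_mat d d" "N * M = 1\<^sub>m d"
    using M by (auto simp: GL_def)
  have "(N * L) * (B * M) = N * ((L * B) * M)"
    using L(1,2) N(1,2) by (simp add: assoc_mult_mat[of _ d d _ n _ d] assoc_mult_mat[of _ d n _ d _ d])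
  then have "(N * L) * (B * M) = 1\<^sub>m d" using L N by simp
  then show ?thesis
    using L N unfolding left_invertible_def by (intro CollectI conjI bexI[of _ "N * L"]) auto
qed

lemma left_invertible_cancel:
  assumes B: "B \<in> left_invertible n d" and "M \<in> carrier_mat d e" "N \<in> carrier_mat d e" "B * M = B * N"
  shows "M = N"
proof -
  obtain L where L: "B \<in> carrier_mat n d" "L \<in> carrier_mat d n" "L * B = 1\<^sub>m d"
    using B by (auto simp: left_invertible_def)
  have "(L * B) * M = (L * B) * N"
    using L(1,2) assms by (simp add: assoc_mult_mat[of _ d n _ d _ e])
  then show ?thesis using L assms by simp
qed

text \<open>Left multiplication by \<open>x\<close> carries the stabiliser of \<open>B\<close> onto
  the fibre through \<open>x\<close>.\<close>

lemma card_SL_fibre: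
  assumes B: "B \<in> carrier_mat n d" and x: "x \<in> SL n"
  shows "card {y \<in> SL n. y * B = x * B} = card {y \<in> SL n. y * B = B}"
proof (rule bij_betw_same_card[of "\<lambda>y. SL_inv x * y"], rule bij_betw_byWitness[where f' = "\<lambda>y. x * y"])
  show "\<forall>a\<in>{y \<in> SL n. y * B = x * B}. x * (SL_inv x * a) = a"
    using SL_inv_cancel(2)[OF x] SL_carrier by auto
  show "\<forall>a'\<in>{y \<in> SL n. y * B = B}. SL_inv x * (x * a') = a'"
    using SL_inv_cancel(1)[OF x] SL_carrier by auto
  show "(\<lambda>y. SL_inv x * y) ` {y \<in> SL n. y * B = x * B} \<subseteq> {y \<in> SL n. y * B = B}"
    using SL_inv(1)[OF x] SL_mult SL_inv_cancel(1)[OF x B] by (auto simp: SL_mult_assoc[OF _ _ B])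
  show "(\<lambda>y. x * y) ` {y \<in> SL n. y * B = B} \<subseteq> {y \<in> SL n. y * B = x * B}"
    using x SL_mult by (auto simp: SL_mult_assoc[OF _ _ B])
qed

text \<open>There are at most \<open>q^(n d)\<close> fibres, none larger than the stabiliser of
  \<open>B\<close>. This is the lower bound \<open>m\<close> of \<open>fibre_sums\<close>.\<close>

lemma card_SL_le_fibre:
  fixes B :: "'a::finite_field mat"
  assumes B: "B \<in> carrier_mat n d"
  shows "card (SL n :: 'a mat set) \<le> CARD('a) ^ (n * d) * card {y \<in> SL n. y * B = B}"
proof -
  have "(SL n :: 'a mat set) = (\<Union>T\<in>carrier_mat n d. {y \<in> SL n. y * B = T})"
    using mult_carrier_mat[OF SL_carrier B] by blast
  then have "card (SL n :: 'a mat set) \<le> (\<Sum>T\<in>carrier_mat n d. card {y \<in> SL n. y * B = T})"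
    using card_UN_le[of "carrier_mat n d :: 'a mat set" "\<lambda>T. {y \<in> SL n. y * B = T}"] by simp
  also have "\<dots> \<le> (\<Sum>T\<in>(carrier_mat n d :: 'a mat set). card {y \<in> SL n. y * B = B})"
  proof (rule sum_mono)
    fix T :: "'a mat" assume "T \<in> carrier_mat n d"
    show "card {y \<in> SL n. y * B = T} \<le> card {y \<in> SL n. y * B = B}"
    proof (cases "\<exists>x\<in>SL n. x * B = T")
      case True
      then show ?thesis using card_SL_fibre[OF B] by auto
    next
      case False
      then have empty: "{y \<in> SL n. y * B = T} = {}" by blast
      show ?thesis unfolding empty by simp
    qed
  qed
  also have "\<dots> = CARD('a) ^ (n * d) * card {y \<in> SL n. y * B = B}"
    by (simp add: card_carrier_mat)
  finally show ?thesis .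
qed

lemma card_SL_pos: "0 < card (SL n :: 'a::finite_field mat set)"
  using one_SL[of n] finite_SL card_gt_0_iff by blast

text \<open>Both sides count matrices fixed by conjugate elements, \<open>y^-1 x\<close> and
  \<open>z^-1 x y^-1 z\<close>; the conjugating element is \<open>z^-1 y\<close>. This is the form
  in which centrality of the summed operator is used.\<close>

lemma card_coincidence_translate:
  fixes x y z :: "'a::finite_field mat"
  assumes xyz: "x \<in> SL n" "y \<in> SL n" "z \<in> SL n"
  shows "card {j \<in> left_invertible n d. x * j = y * j} =
    card {j \<in> left_invertible n d. (x * (SL_inv y * z)) * j = z * j}"
proof (rule bij_betw_same_card[of "\<lambda>j. SL_inv z * (y * j)"],
    rule bij_betw_byWitness[where f' = "\<lambda>j. SL_inv y * (z * j)"])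
  note S = xyz SL_inv(1)[OF xyz(2)] SL_inv(1)[OF xyz(3)]
  have c: "j \<in> carrier_mat n d" if "j \<in> left_invertible n d" for j :: "'a mat"
    using that by (simp add: left_invertible_def)
  have c': "g * j \<in> carrier_mat n d" if "g \<in> SL n" "j \<in> carrier_mat n d" for g j :: "'a mat"
    using that SL_carrier[OF that(1)] by simp
  have a: "(x * (SL_inv y * z)) * j = x * (SL_inv y * (z * j))" if "j \<in> carrier_mat n d" for j :: "'a mat"
    unfolding SL_mult_assoc[OF S(1) SL_mult[OF S(4,3)] that] SL_mult_assoc[OF S(4,3) that] ..
  note can = SL_inv_cancel[OF xyz(2), where d = d] SL_inv_cancel[OF xyz(3), where d = d]
  show "\<forall>j\<in>{j \<in> left_invertible n d. x * j = y * j}. SL_inv y * (z * (SL_inv z * (y * j))) = j"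
    using c c' S can by simp
  show "\<forall>j\<in>{j \<in> left_invertible n d. (x * (SL_inv y * z)) * j = z * j}. SL_inv z * (y * (SL_inv y * (z * j))) = j"
    using c c' S can by simp
  show "(\<lambda>j. SL_inv z * (y * j)) ` {j \<in> left_invertible n d. x * j = y * j}
    \<subseteq> {j \<in> left_invertible n d. (x * (SL_inv y * z)) * j = z * j}"
  proof (rule image_subsetI, clarify, intro conjI)
    fix j assume j: "j \<in> left_invertible n d" "x * j = y * j"
    show "SL_inv z * (y * j) \<in> left_invertible n d"
      using left_invertible_SL_mult j S by blast
    show "(x * (SL_inv y * z)) * (SL_inv z * (y * j)) = z * (SL_inv z * (y * j))"
      using j c[OF j(1)] c' S can by (simp add: a)
  qed
  show "(\<lambda>j. SL_inv y * (z * j)) ` {j \<in> left_invertible n d. (x * (SL_inv y * z)) * j = z * j}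
    \<subseteq> {j \<in> left_invertible n d. x * j = y * j}"
  proof (rule image_subsetI, clarify, intro conjI)
    fix j assume j: "j \<in> left_invertible n d" "(x * (SL_inv y * z)) * j = z * j"
    show "SL_inv y * (z * j) \<in> left_invertible n d"
      using left_invertible_SL_mult j S by blast
    show "x * (SL_inv y * (z * j)) = y * (SL_inv y * (z * j))"
      using j c[OF j(1)] c' S can by (simp add: a)
  qed
qed

lemma SL_fibre_sums:
  "fibre_sums (SL n :: 'a::finite_field mat set) (left_invertible n d) (\<lambda>B g. g * B)
    (\<lambda>B. card {y \<in> SL n. y * B = B})
    (real (card (SL n :: 'a mat set)) / real (CARD('a) ^ (n * d))) (real (card (GL d :: 'a mat set)))"
proof
  show "finite (SL n :: 'a mat set)" by simp
  show "finite (left_invertible n d :: 'a mat set)" by (rule finite_left_invertible)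
  show "0 < real (card (SL n :: 'a mat set)) / real (CARD('a) ^ (n * d))"
    using card_SL_pos[of n, where ?'a = 'a] by simp
  fix B :: "'a mat" assume B: "B \<in> left_invertible n d"
  then have Bc: "B \<in> carrier_mat n d" by (simp add: left_invertible_def)
  show "card {y \<in> SL n. y * B = x * B} = card {y \<in> SL n. y * B = B}" if "x \<in> SL n" for x
    by (rule card_SL_fibre[OF Bc that])
  show "real (card (SL n :: 'a mat set)) / real (CARD('a) ^ (n * d)) \<le> real (card {y \<in> SL n. y * B = B})"
  proof -
    have "real (card (SL n :: 'a mat set)) \<le> real (CARD('a) ^ (n * d)) * real (card {y \<in> SL n. y * B = B})"
      using card_SL_le_fibre[OF Bc] by (metis of_nat_le_iff of_nat_mult)
    then show ?thesis by (simp add: divide_le_eq mult.commute)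
  qed
  show "real (card (GL d :: 'a mat set))
    \<le> real (card {j \<in> left_invertible n d. \<forall>x\<in>SL n. \<forall>y\<in>SL n. (x * j = y * j) = (x * B = y * B)})"
  proof -
    \<comment> \<open>Passing from \<open>B\<close> to \<open>B * M\<close> changes the basis of a
      subspace but not the fibres, which accounts for the multiplicity \<open>c\<close>.\<close>
    have "inj_on (\<lambda>M. B * M) (GL d)"
      by (rule inj_onI) (use left_invertible_cancel[OF B, of _ d] in \<open>auto simp: GL_def\<close>)
    moreover have "(\<lambda>M. B * M) ` GL d \<subseteq> {j \<in> left_invertible n d. \<forall>x\<in>SL n. \<forall>y\<in>SL n. (x * j = y * j) = (x * B = y * B)}"
    proof (rule image_subsetI, intro CollectI conjI ballI)
      fix M :: "'a mat" assume M: "M \<in> GL d"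
      show "B * M \<in> left_invertible n d" by (rule left_invertible_GL_mult[OF B M])
      fix x y :: "'a mat" assume xy: "x \<in> SL n" "y \<in> SL n"
      obtain N where N: "M \<in> carrier_mat d d" "N \<in> carrier_mat d d" "M * N = 1\<^sub>m d"
        using M by (auto simp: GL_def)
      have a: "g * (B * M) = (g * B) * M" "((g * B) * M) * N = g * B" if "g \<in> SL n" for g
      proof -
        have gB: "g * B \<in> carrier_mat n d" using SL_carrier[OF that] Bc by simp
        show "g * (B * M) = (g * B) * M"
          using assoc_mult_mat[OF SL_carrier[OF that] Bc N(1)] by simp
        show "((g * B) * M) * N = g * B"
          using assoc_mult_mat[OF gB N(1,2)] N(3) right_mult_one_mat[OF gB] by simp
      qed
      show "(x * (B * M) = y * (B * M)) = (x * B = y * B)"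
        unfolding a(1)[OF xy(1)] a(1)[OF xy(2)] using a(2)[OF xy(1)] a(2)[OF xy(2)] by metis
    qed
    ultimately show ?thesis
      by (intro of_nat_mono card_inj_on_le[of "\<lambda>M. B * M"]) (auto simp: finite_left_invertible)
  qed
  show "(\<Sum>y\<in>{y \<in> SL n. y * B = z * B}. card {j \<in> left_invertible n d. x * j = y * j}) =
    (\<Sum>y\<in>{y \<in> SL n. y * B = x * B}. card {j \<in> left_invertible n d. y * j = z * j})"
    if xz: "x \<in> SL n" "z \<in> SL n" for x z
  proof (rule sum.reindex_bij_witness[of _ "\<lambda>y. z * (SL_inv y * x)" "\<lambda>y. x * (SL_inv y * z)"])
    \<comment> \<open>The substitution \<open>y -> x y^-1 z\<close> exchanges the fibre of
      \<open>z\<close> with the fibre of \<open>x\<close>. Taking \<open>(a, b)\<close> to be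
      \<open>(z, x)\<close> and \<open>(x, z)\<close> gives its two directions; the summands match
      by \<open>card_coincidence_translate\<close>.\<close>
    have wit: "a * (SL_inv (b * (SL_inv y * a)) * b) = y"
      "b * (SL_inv y * a) \<in> {y \<in> SL n. y * B = b * B}"
      if "a \<in> SL n" "b \<in> SL n" "y \<in> SL n" "y * B = a * B" for a b y
    proof -
      note S = that(1-3) SL_inv(1)[OF that(1)] SL_inv(1)[OF that(2)] SL_inv(1)[OF that(3)]
      note can = SL_inv_cancel[OF that(1), where d = n] SL_inv_cancel[OF that(2), where d = n]
        SL_inv_cancel[OF that(3), where d = n] SL_inv_cancel[OF that(3) Bc]
      note C = S[THEN SL_carrier]
      have "(SL_inv a * (y * SL_inv b)) * (b * (SL_inv y * a)) = SL_inv a * (y * (SL_inv b * (b * (SL_inv y * a))))"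
        using C by (simp add: assoc_mult_mat[of _ n n _ n _ n])
      also have "\<dots> = 1\<^sub>m n" using C can SL_inv(2)[OF that(1)] by simp
      finally have "SL_inv (b * (SL_inv y * a)) = SL_inv a * (y * SL_inv b)"
        using S by (intro SL_inv_unique[of _ n]) (auto intro!: SL_mult)
      moreover have "a * ((SL_inv a * (y * SL_inv b)) * b) = a * (SL_inv a * (y * (SL_inv b * b)))"
        using C by (simp add: assoc_mult_mat[of _ n n _ n _ n])
      ultimately show "a * (SL_inv (b * (SL_inv y * a)) * b) = y"
        using C can SL_inv(2)[OF that(2)] by simp
      have "(b * (SL_inv y * a)) * B = b * (SL_inv y * (a * B))"
        using C Bc by (simp add: assoc_mult_mat[of _ n n _ n _ d])
      also have "\<dots> = b * B" unfolding that(4)[symmetric] using can Bc by simp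
      finally show "b * (SL_inv y * a) \<in> {y \<in> SL n. y * B = b * B}" using S by (auto intro!: SL_mult)
    qed
    fix y
    show "y \<in> {y \<in> SL n. y * B = z * B} \<Longrightarrow> z * (SL_inv (x * (SL_inv y * z)) * x) = y"
      using wit(1)[of z x y] xz by simp
    show "y \<in> {y \<in> SL n. y * B = z * B} \<Longrightarrow> x * (SL_inv y * z) \<in> {y \<in> SL n. y * B = x * B}"
      using wit(2)[of z x y] xz by simp
    show "y \<in> {y \<in> SL n. y * B = x * B} \<Longrightarrow> x * (SL_inv (z * (SL_inv y * x)) * z) = y"
      using wit(1)[of x z y] xz by simp
    show "y \<in> {y \<in> SL n. y * B = x * B} \<Longrightarrow> z * (SL_inv y * x) \<in> {y \<in> SL n. y * B = z * B}"
      using wit(2)[of x z y] xz by simp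
    show "y \<in> {y \<in> SL n. y * B = z * B} \<Longrightarrow>
      card {j \<in> left_invertible n d. (x * (SL_inv y * z)) * j = z * j} =
      card {j \<in> left_invertible n d. x * j = y * j}"
      using card_coincidence_translate[of x n y z d] xz by simp
  qed
qed simp

section \<open>Functions of a given level\<close>

text \<open>The recursion acts on one entry at a time; unrolled, it is the diagonal action on
  tuples.\<close>

lemma tensor_power_perm_rep:
  assumes g: "g \<in> SL n"
  shows "tensor_power d (perm_rep n g) F ys =
    (if ys \<in> tuples d (carrier_vec n) then F (map ((*\<^sub>v) (SL_inv g)) ys) else 0)"
proof (induction d arbitrary: F ys)
  case 0
  show ?case by (auto simp: tuples_def)
next
  case (Suc d)
  show ?case
  proof (cases ys)
    case (Cons x zs)
    have "tensor_power (Suc d) (perm_rep n g) F ys =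
      perm_rep n g (\<lambda>x'. tensor_power d (perm_rep n g) (\<lambda>ys'. F (x' # ys')) zs) x"
      by (simp add: Cons)
    also have "\<dots> = perm_rep n g (\<lambda>x'. if zs \<in> tuples d (carrier_vec n)
        then F (x' # map ((*\<^sub>v) (SL_inv g)) zs) else 0) x"
      by (simp only: Suc.IH)
    finally have eq: "tensor_power (Suc d) (perm_rep n g) F ys = \<dots>" .
    show ?thesis unfolding eq by (auto simp: Cons perm_rep_def tuples_def)
  qed (simp add: tuples_def)
qed

section \<open>The diagonal action on tuples, and tuples as matrices\<close>

lemma SL_inv_mult_vec:
  assumes g: "g \<in> SL n" and v: "v \<in> carrier_vec n"
  shows "SL_inv g *\<^sub>v (g *\<^sub>v v) = v" "g *\<^sub>v (SL_inv g *\<^sub>v v) = v"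
  using SL_carrier[OF g] SL_carrier[OF SL_inv(1)[OF g]] SL_inv(2,3)[OF g] v
  by (simp_all flip: assoc_mult_mat_vec[of _ n n _ n])

lemma map_SL_tuples:
  "g \<in> SL n \<Longrightarrow> ys \<in> tuples d (carrier_vec n) \<Longrightarrow> map ((*\<^sub>v) g) ys \<in> tuples d (carrier_vec n)"
  by (auto simp: tuples_def intro!: mult_mat_vec_carrier[OF SL_carrier])

lemma map_SL_cancel:
  assumes "g \<in> SL n" "ys \<in> tuples d (carrier_vec n)"
  shows "map ((*\<^sub>v) (SL_inv g)) (map ((*\<^sub>v) g) ys) = ys"
    "map ((*\<^sub>v) g) (map ((*\<^sub>v) (SL_inv g)) ys) = ys"
  using assms SL_inv_mult_vec[OF assms(1)] by (auto simp: tuples_def intro!: map_idI)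

lemma map_SL_mult:
  assumes "g \<in> SL n" "h \<in> SL n" "ys \<in> tuples d (carrier_vec n)"
  shows "map ((*\<^sub>v) (g * h)) ys = map ((*\<^sub>v) g) (map ((*\<^sub>v) h) ys)"
  using assms(3) assoc_mult_mat_vec[OF SL_carrier[OF assms(1)] SL_carrier[OF assms(2)]]
  by (auto simp: tuples_def)

lemma cols_in_tuples: "B \<in> carrier_mat n d \<Longrightarrow> cols B \<in> tuples d (carrier_vec n)"
  using cols_dim[of B] by (auto simp: tuples_def)

lemma cols_mult:
  assumes "g \<in> carrier_mat n n" "B \<in> carrier_mat n d"
  shows "cols (g * B) = map ((*\<^sub>v) g) (cols B)"
  using assms by (intro nth_equalityI) (auto intro!: eq_vecI)

text \<open>The bridge from tuples, in which tensor powers are expressed, to matrices, in which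
  fibres are.\<close>

lemma mult_eq_iff_cols:
  assumes g: "g \<in> SL n" and B: "B \<in> carrier_mat n d" and T: "T \<in> carrier_mat n d"
  shows "g * B = T \<longleftrightarrow> map ((*\<^sub>v) g) (cols B) = cols T"
proof -
  have gB: "g * B \<in> carrier_mat n d" using SL_carrier[OF g] B by simp
  have "g * B = T \<longleftrightarrow> cols (g * B) = cols T"
    using mat_of_cols_cols[of "g * B"] mat_of_cols_cols[of T] gB T by (metis carrier_matD(1))
  then show ?thesis by (simp add: cols_mult[OF SL_carrier[OF g] B])
qed

lemma zero_smult_zero_vec: "0 \<cdot>\<^sub>v 0\<^sub>v k = (0\<^sub>v k :: complex Matrix.vec)"
  by (intro eq_vecI) auto

lemma finite_tuples: "finite X \<Longrightarrow> finite (tuples d X)"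
  unfolding tuples_def using finite_lists_length_eq[of X d] by (simp add: conj_commute)

text \<open>
  A matrix coefficient with a nonzero sum over some fibre of \<open>g \<mapsto> (g y\<^sub>1, \<dots>, g y\<^sub>d)\<close> would give,
  for the fixed vector \<open>u\<close>, a nonzero and hence injective equivariant map into \<open>\<omega>\<^sup>\<otimes>\<^sup>d\<close>.
\<close>

lemma matrix_coeff_fibre_sum_eq_0:
  assumes irr: "is_irrep n k \<rho>" and nsub: "\<not> subrep_tensor_power n k \<rho> d"
    and v: "v \<in> carrier_vec k" and u: "u \<in> carrier_vec k"
    and ys: "ys \<in> tuples d (carrier_vec n)"
  shows "(\<Sum>g\<in>{g \<in> SL n. map ((*\<^sub>v) g) ys = xs}. matrix_coeff n \<rho> v u g) = 0"
proof -
  have \<rho>c: "\<And>g. g \<in> SL n \<Longrightarrow> \<rho> g \<in> carrier_mat k k"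
    and \<rho>m: "\<And>g h. g \<in> SL n \<Longrightarrow> h \<in> SL n \<Longrightarrow> \<rho> (g * h) = \<rho> g * \<rho> h"
    and irr': "\<And>W. subspace class_ring W (module_vec TYPE(complex) k) \<Longrightarrow>
      (\<forall>g\<in>SL n. \<forall>w\<in>W. \<rho> g *\<^sub>v w \<in> W) \<Longrightarrow> W = {0\<^sub>v k} \<or> W = carrier_vec k"
    using irr unfolding is_irrep_def is_rep_def by blast+
  define \<Theta> where "\<Theta> v zs = (if zs \<in> tuples d (carrier_vec n)
    then \<Sum>g\<in>{g \<in> SL n. map ((*\<^sub>v) g) zs = xs}. (\<rho> g *\<^sub>v v) \<bullet>c u else 0)" for v zs
  have L2: "\<Theta> \<in> carrier_vec k \<rightarrow> L2 (tuples d (carrier_vec n))"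
    by (auto simp: L2_def \<Theta>_def)
  have add: "\<Theta> (v + w) zs = \<Theta> v zs + \<Theta> w zs" if "v \<in> carrier_vec k" "w \<in> carrier_vec k" for v w zs
  proof -
    have "(\<rho> g *\<^sub>v (v + w)) \<bullet>c u = (\<rho> g *\<^sub>v v) \<bullet>c u + (\<rho> g *\<^sub>v w) \<bullet>c u" if g: "g \<in> SL n" for g
      using \<open>v \<in> carrier_vec k\<close> \<open>w \<in> carrier_vec k\<close> u \<rho>c[OF g]
      by (simp add: mult_add_distrib_mat_vec[of _ k k] add_scalar_prod_distrib[of _ k])
    then show ?thesis by (simp add: \<Theta>_def sum.distrib)
  qed
  have smult: "\<Theta> (c \<cdot>\<^sub>v v) zs = c * \<Theta> v zs" if "v \<in> carrier_vec k" for c v zs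
  proof -
    have "(\<rho> g *\<^sub>v (c \<cdot>\<^sub>v v)) \<bullet>c u = c * ((\<rho> g *\<^sub>v v) \<bullet>c u)" if g: "g \<in> SL n" for g
      using \<open>v \<in> carrier_vec k\<close> u \<rho>c[OF g] by (simp add: mult_mat_vec[of _ k k])
    then show ?thesis by (simp add: \<Theta>_def sum_distrib_left)
  qed
  have equi: "\<Theta> (\<rho> h *\<^sub>v v) = tensor_power d (perm_rep n h) (\<Theta> v)"
    if h: "h \<in> SL n" and v: "v \<in> carrier_vec k" for h v
  proof
    fix zs
    show "\<Theta> (\<rho> h *\<^sub>v v) zs = tensor_power d (perm_rep n h) (\<Theta> v) zs"
    proof (cases "zs \<in> tuples d (carrier_vec n)")
      case zs: True
      note hi = SL_inv(1)[OF h]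
      \<comment> \<open>Substituting \<open>g * h\<close> for the summation variable moves
        \<open>h\<close> from the vector to the tuple, since \<open>g h\<close> sends
        \<open>h^-1 zs\<close> to \<open>g zs\<close>.\<close>
      have "\<Theta> (\<rho> h *\<^sub>v v) zs =
        (\<Sum>g\<in>{g \<in> SL n. map ((*\<^sub>v) g) (map ((*\<^sub>v) (SL_inv h)) zs) = xs}. (\<rho> g *\<^sub>v v) \<bullet>c u)"
        unfolding \<Theta>_def if_P[OF zs]
      proof (rule sum.reindex_bij_witness[of _ "\<lambda>g. g * SL_inv h" "\<lambda>g. g * h"], goal_cases)
        case (1 g)
        then show ?case using h hi SL_carrier[of g n] SL_carrier[OF h] SL_carrier[OF hi] SL_inv(3)[OF h]
          by (simp add: assoc_mult_mat[of _ n n _ n _ n])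
      next
        case (2 g)
        then show ?case using h map_SL_mult[of g n h, OF _ h map_SL_tuples[OF hi zs]] map_SL_cancel(2)[OF h zs]
          by (auto simp del: map_map intro!: SL_mult)
      next
        case (3 g)
        then show ?case using h hi SL_carrier[of g n] SL_carrier[OF h] SL_carrier[OF hi] SL_inv(2)[OF h]
          by (simp add: assoc_mult_mat[of _ n n _ n _ n])
      next
        case (4 g)
        then show ?case using map_SL_mult[of g n "SL_inv h", OF _ hi zs]
          by (auto simp del: map_map intro!: SL_mult hi)
      next
        case (5 g)
        then show ?case using \<rho>m[of g h] h v \<rho>c[of g] \<rho>c[OF h]
          by (simp add: assoc_mult_mat_vec[of _ k k _ k])
      qed
      then show ?thesis
        unfolding tensor_power_perm_rep[OF h] if_P[OF zs] using map_SL_tuples[OF hi zs] by (simp add: \<Theta>_def)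
    qed (simp add: tensor_power_perm_rep[OF h] \<Theta>_def)
  qed
  have "\<not> inj_on \<Theta> (carrier_vec k)"
    using nsub L2 add smult equi unfolding subrep_tensor_power_def by blast
  \<comment> \<open>The kernel of \<open>\<Theta>\<close> is an invariant subspace; it is nonzero
    because \<open>\<Theta>\<close> is not injective, so irreducibility makes it everything.\<close>
  define W where "W = {v \<in> carrier_vec k. \<forall>zs. \<Theta> v zs = 0}"
  have zero: "\<Theta> (0\<^sub>v k) zs = 0" for zs
    using smult[of "0\<^sub>v k" 0 zs] zero_smult_zero_vec[of k] by simp
  have "W \<noteq> {0\<^sub>v k}"
  proof
    assume W0: "W = {0\<^sub>v k}"
    have "inj_on \<Theta> (carrier_vec k)"
    proof (rule inj_onI)
      fix v w assume vw: "v \<in> carrier_vec k" "w \<in> carrier_vec k" "\<Theta> v = \<Theta> w"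
      have "\<Theta> (v + (- 1) \<cdot>\<^sub>v w) zs = 0" for zs
        using add[OF vw(1), of "(- 1) \<cdot>\<^sub>v w" zs] smult[OF vw(2), of "- 1" zs] vw by simp
      then have "v + (- 1) \<cdot>\<^sub>v w \<in> W" using vw by (simp add: W_def)
      then have e: "v + (- 1) \<cdot>\<^sub>v w = 0\<^sub>v k" using W0 by simp
      show "v = w"
      proof (rule eq_vecI)
        fix i assume "i < dim_vec w"
        then show "v $ i = w $ i" using arg_cong[OF e, of "\<lambda>x. x $ i"] vw by simp
      qed (use vw in auto)
    qed
    then show False using \<open>\<not> inj_on \<Theta> (carrier_vec k)\<close> by contradiction
  qed
  moreover have "subspace class_ring W (module_vec TYPE(complex) k)"
  proof -
    interpret vec_space "TYPE(complex)" k .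
    show ?thesis
      unfolding subspace_def submodule_def
      using vectorspace_axioms module_axioms zero
      by (auto simp: W_def module_vec_simps add smult class_ring_simps)
  qed
  moreover have "\<forall>g\<in>SL n. \<forall>w\<in>W. \<rho> g *\<^sub>v w \<in> W"
  proof (intro ballI)
    fix g :: "'a mat" and w assume g: "g \<in> SL n" and w: "w \<in> W"
    then have "w \<in> carrier_vec k" by (simp add: W_def)
    then show "\<rho> g *\<^sub>v w \<in> W"
      using w \<rho>c[OF g] equi[OF g] by (auto simp: W_def tensor_power_perm_rep[OF g])
  qed
  ultimately have "W = carrier_vec k" using irr' by blast
  then have "\<Theta> v ys = 0" using v by (auto simp: W_def)
  then show ?thesis using ys by (simp add: \<Theta>_def matrix_coeff_def)
qed

text \<open>Linearity is assumed at a single point \<open>z\<close>, so that this serves both for an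
  embedding \<open>T\<close> evaluated at a tuple and, with a dummy \<open>z\<close>, for the scalar
  product with \<open>u\<close>.\<close>

lemma additive_homogeneous_sum:
  fixes T :: "complex vec \<Rightarrow> 'z \<Rightarrow> complex"
  assumes add: "\<And>v w. v \<in> carrier_vec k \<Longrightarrow> w \<in> carrier_vec k \<Longrightarrow> T (v + w) z = T v z + T w z"
    and smult: "\<And>c v. v \<in> carrier_vec k \<Longrightarrow> T (c \<cdot>\<^sub>v v) z = c * T v z"
    and x: "\<And>g. g \<in> A \<Longrightarrow> x g \<in> carrier_vec k" and "finite A"
  shows "T (Matrix.vec k (\<lambda>i. \<Sum>g\<in>A. c g * x g $ i)) z = (\<Sum>g\<in>A. c g * T (x g) z)"
  using \<open>finite A\<close> x
proof (induction A)
  case empty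
  have "Matrix.vec k (\<lambda>i. 0) = 0 \<cdot>\<^sub>v (0\<^sub>v k :: complex vec)" by auto
  then show ?case using smult[of "0\<^sub>v k" 0] by simp
next
  case (insert a A)
  have "Matrix.vec k (\<lambda>i. \<Sum>g\<in>insert a A. c g * x g $ i) =
    c a \<cdot>\<^sub>v x a + Matrix.vec k (\<lambda>i. \<Sum>g\<in>A. c g * x g $ i)"
    using insert.hyps insert.prems[of a] by (intro eq_vecI) auto
  then show ?case using insert by (simp add: add smult)
qed

text \<open>
  The vector \<open>\<Sum>\<^sub>g cnj (\<kappa> g) \<rho>(g) v\<close> is killed by the embedding of \<open>\<rho>\<close> into \<open>\<omega>\<^sup>\<otimes>\<^sup>d\<close>, hence zero.
\<close>

lemma matrix_coeff_orthogonal: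
  assumes irr: "is_irrep n k \<rho>" and sub: "subrep_tensor_power n k \<rho> d"
    and v: "v \<in> carrier_vec k" and u: "u \<in> carrier_vec k"
    and \<kappa>: "\<And>zs ys. zs \<in> tuples d (carrier_vec n) \<Longrightarrow> ys \<in> tuples d (carrier_vec n) \<Longrightarrow>
      (\<Sum>g\<in>{g \<in> SL n. map ((*\<^sub>v) g) zs = ys}. \<kappa> g) = 0"
  shows "ip (SL n) (matrix_coeff n \<rho> v u) \<kappa> = 0"
proof -
  have \<rho>c: "\<And>g. g \<in> SL n \<Longrightarrow> \<rho> g \<in> carrier_mat k k"
    using irr unfolding is_irrep_def is_rep_def by blast
  obtain T where T: "T \<in> carrier_vec k \<rightarrow> L2 (tuples d (carrier_vec n))"
    "\<And>v w xs. v \<in> carrier_vec k \<Longrightarrow> w \<in> carrier_vec k \<Longrightarrow> T (v + w) xs = T v xs + T w xs"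
    "\<And>c v xs. v \<in> carrier_vec k \<Longrightarrow> T (c \<cdot>\<^sub>v v) xs = c * T v xs"
    "inj_on T (carrier_vec k)"
    "\<And>g v. g \<in> SL n \<Longrightarrow> v \<in> carrier_vec k \<Longrightarrow> T (\<rho> g *\<^sub>v v) = tensor_power d (perm_rep n g) (T v)"
    using sub unfolding subrep_tensor_power_def by blast
  define w where "w = Matrix.vec k (\<lambda>i. \<Sum>g\<in>SL n. cnj (\<kappa> g) * (\<rho> g *\<^sub>v v) $ i)"
  have w: "w \<in> carrier_vec k" by (simp add: w_def)
  have "T w ys = 0" for ys
  proof -
    have Tw: "T w ys = (\<Sum>g\<in>SL n. cnj (\<kappa> g) * T (\<rho> g *\<^sub>v v) ys)"
      unfolding w_def using T(2,3) mult_mat_vec_carrier[OF \<rho>c v] by (intro additive_homogeneous_sum[of k]) auto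
    show ?thesis
    proof (cases "ys \<in> tuples d (carrier_vec n)")
      case ys: True
      have "T w ys = (\<Sum>g\<in>SL n. cnj (\<kappa> g) * T v (map ((*\<^sub>v) (SL_inv g)) ys))"
        unfolding Tw using ys v by (intro sum.cong) (auto simp: T(5) tensor_power_perm_rep)
      \<comment> \<open>For each \<open>g\<close> exactly one \<open>zs\<close> is sent to
        \<open>ys\<close>. Making it a summation variable and exchanging the sums brings out the
        fibre sums of \<open>\<kappa>\<close>.\<close>
      also have "\<dots> = (\<Sum>g\<in>SL n. \<Sum>zs\<in>tuples d (carrier_vec n).
          if map ((*\<^sub>v) g) zs = ys then cnj (\<kappa> g) * T v zs else 0)"
      proof (rule sum.cong[OF refl])
        fix g :: "'a mat" assume g: "g \<in> SL n"
        have "map ((*\<^sub>v) g) zs = ys \<longleftrightarrow> zs = map ((*\<^sub>v) (SL_inv g)) ys"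
          if "zs \<in> tuples d (carrier_vec n)" for zs
          using map_SL_cancel[OF g that] map_SL_cancel[OF g ys] by metis
        then have "(\<Sum>zs\<in>tuples d (carrier_vec n). if map ((*\<^sub>v) g) zs = ys then cnj (\<kappa> g) * T v zs else 0) =
          (\<Sum>zs\<in>tuples d (carrier_vec n). if zs = map ((*\<^sub>v) (SL_inv g)) ys then cnj (\<kappa> g) * T v zs else 0)"
          by (intro sum.cong) auto
        then show "cnj (\<kappa> g) * T v (map ((*\<^sub>v) (SL_inv g)) ys) =
          (\<Sum>zs\<in>tuples d (carrier_vec n). if map ((*\<^sub>v) g) zs = ys then cnj (\<kappa> g) * T v zs else 0)"
          using map_SL_tuples[OF SL_inv(1)[OF g] ys] by (simp add: finite_tuples)
      qed
      also have "\<dots> = (\<Sum>zs\<in>tuples d (carrier_vec n). T v zs *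
          cnj (\<Sum>g\<in>{g \<in> SL n. map ((*\<^sub>v) g) zs = ys}. \<kappa> g))"
        by (subst sum.swap) (auto simp: sum_distrib_left sum.If_cases Int_def mult.commute intro!: sum.cong)
      also have "\<dots> = 0" using \<kappa>[OF _ ys] by simp
      finally show ?thesis .
    next
      case False
      then show ?thesis using T(1) w by (auto simp: L2_def)
    qed
  qed
  moreover have "T (0\<^sub>v k) ys = 0" for ys 
    using T(3)[of "0\<^sub>v k" 0 ys] zero_smult_zero_vec[of k] by simp
  ultimately have "T w = T (0\<^sub>v k)" by (intro ext) simp
  then have w0: "w = 0\<^sub>v k" using T(4) w by (auto dest: inj_onD)
  have "ip (SL n) (matrix_coeff n \<rho> v u) \<kappa> = (\<Sum>g\<in>SL n. cnj (\<kappa> g) * ((\<rho> g *\<^sub>v v) \<bullet>c u))"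
    unfolding ip_def by (intro sum.cong) (auto simp: matrix_coeff_def)
  also have "\<dots> = w \<bullet>c u"
    using u mult_mat_vec_carrier[OF \<rho>c v] unfolding w_def
    by (intro additive_homogeneous_sum[of k "\<lambda>v _. v \<bullet>c u", symmetric])
      (auto simp: add_scalar_prod_distrib[of _ k])
  also have "\<dots> = 0" using u by (simp add: w0)
  finally show ?thesis .
qed

section \<open>From matrix coefficients to their span\<close>

lemma L2_SL_level_induct [consumes 1, case_names zero add scale matrix_coeff]:
  assumes f: "f \<in> L2_SL_level n d"
    and P0: "P (\<lambda>_. 0)" and Padd: "\<And>f g. P f \<Longrightarrow> P g \<Longrightarrow> P (\<lambda>x. f x + g x)"
    and Psc: "\<And>c f. P f \<Longrightarrow> P (\<lambda>x. c * f x)"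
    and Pm: "\<And>k \<rho> v u. is_irrep n k \<rho> \<Longrightarrow> has_tensor_rank n k \<rho> d \<Longrightarrow> v \<in> carrier_vec k \<Longrightarrow>
      u \<in> carrier_vec k \<Longrightarrow> P (matrix_coeff n \<rho> v u)"
  shows "P f"
  using f unfolding L2_SL_level_def
proof (induction rule: cfun.span_induct_alt)
  case base
  show ?case using P0 by (simp add: zero_fun_def)
next
  case (step c x y)
  then obtain k \<rho> v u where "x = matrix_coeff n \<rho> v u" "is_irrep n k \<rho>" "has_tensor_rank n k \<rho> d"
    "v \<in> carrier_vec k" "u \<in> carrier_vec k" by blast
  then have "P (\<lambda>z. c * x z + y z)" using Padd[OF Psc[OF Pm] step(2)] by blast
  then show ?case by (simp add: plus_fun_def)
qed

text \<open>The negative half of \<open>has_tensor_rank\<close>. Width \<open>d - 1\<close> is also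
  what \<open>right_invertible_or_factor\<close> produces from a \<open>Y\<close> without right
  inverse.\<close>

lemma level_fibre_sum_eq_0:
  assumes f: "f \<in> L2_SL_level n d" and "0 < d"
    and B: "B \<in> carrier_mat n (d - 1)" and T: "T \<in> carrier_mat n (d - 1)"
  shows "(\<Sum>g\<in>{g \<in> SL n. g * B = T}. f g) = 0"
  using f
proof (induction rule: L2_SL_level_induct)
  case (matrix_coeff k \<rho> v u)
  have "{g \<in> SL n. g * B = T} = {g \<in> SL n. map ((*\<^sub>v) g) (cols B) = cols T}"
    using mult_eq_iff_cols[OF _ B T] by blast
  then show ?case
    using matrix_coeff_fibre_sum_eq_0[OF matrix_coeff(1) _ matrix_coeff(3,4) cols_in_tuples[OF B]] matrix_coeff(2) \<open>0 < d\<close>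
    by (simp add: has_tensor_rank_def)
qed (simp_all add: sum.distrib flip: sum_distrib_left)

text \<open>The positive half of \<open>has_tensor_rank\<close>. It provides the hypothesis of
  \<open>ip_K_ge\<close>, where the vanishing of every \<open>P i k\<close> means that all fibre
  sums are 0.\<close>

lemma level_orthogonal:
  assumes f: "f \<in> L2_SL_level n d" and "d \<le> n"
    and \<kappa>: "\<And>B T. B \<in> left_invertible n d \<Longrightarrow> T \<in> carrier_mat n d \<Longrightarrow>
      (\<Sum>g\<in>{g \<in> SL n. g * B = T}. \<kappa> g) = 0"
  shows "ip (SL n) f \<kappa> = 0"
proof -
  have all: "(\<Sum>g\<in>{g \<in> SL n. g * B = T}. \<kappa> g) = 0" if B: "B \<in> carrier_mat n d" for B T
  proof -
    obtain B' C L where B': "B' \<in> carrier_mat n d" "C \<in> carrier_mat d d" "L \<in> carrier_mat d n"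
      "B = B' * C" "L * B' = 1\<^sub>m d"
      using factor_left_invertible[OF B \<open>d \<le> n\<close>] by blast
    have Bi: "B' \<in> left_invertible n d" using B' by (auto simp: left_invertible_def)
    have gB: "g * B = (g * B') * C" if "g \<in> SL n" for g
      unfolding B'(4) using SL_carrier[OF that] B' by (simp add: assoc_mult_mat[of _ n n _ d _ d])
    \<comment> \<open>As \<open>C\<close> may be singular, a fibre of \<open>B\<close> can be a
      disjoint union of several fibres of the left invertible \<open>B'\<close>.\<close>
    have "(\<Sum>g\<in>{g \<in> SL n. g * B = T}. \<kappa> g) = (\<Sum>g\<in>(\<Union>S\<in>{S \<in> carrier_mat n d. S * C = T}. {g \<in> SL n. g * B' = S}). \<kappa> g)"
      using gB mult_carrier_mat[OF SL_carrier B'(1)] by (intro sum.cong) auto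
    also have "\<dots> = (\<Sum>S\<in>{S \<in> carrier_mat n d. S * C = T}. \<Sum>g\<in>{g \<in> SL n. g * B' = S}. \<kappa> g)"
      by (rule sum.UNION_disjoint) (auto intro: finite_subset[OF _ finite_carrier_mat[of n d]])
    also have "\<dots> = 0" using \<kappa>[OF Bi] by simp
    finally show ?thesis .
  qed
  show ?thesis using f
  proof (induction rule: L2_SL_level_induct)
    case (matrix_coeff k \<rho> v u)
    show ?case
    proof (rule matrix_coeff_orthogonal[OF matrix_coeff(1) _ matrix_coeff(3,4)])
      show "subrep_tensor_power n k \<rho> d" using matrix_coeff(2) by (simp add: has_tensor_rank_def)
      fix zs ys :: "'a Matrix.vec list"
      assume zs: "zs \<in> tuples d (carrier_vec n)" and ys: "ys \<in> tuples d (carrier_vec n)"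
      have cz: "cols (mat_of_cols n zs) = zs" "cols (mat_of_cols n ys) = ys"
        and mz: "mat_of_cols n zs \<in> carrier_mat n d" "mat_of_cols n ys \<in> carrier_mat n d"
        using zs ys by (auto simp: tuples_def)
      have "{g \<in> SL n. map ((*\<^sub>v) g) zs = ys} = {g \<in> SL n. g * mat_of_cols n zs = mat_of_cols n ys}"
        using mult_eq_iff_cols[OF _ mz] unfolding cz by blast
      then show "(\<Sum>g\<in>{g \<in> SL n. map ((*\<^sub>v) g) zs = ys}. \<kappa> g) = 0" using all[OF mz(1)] by simp
    qed
  qed (simp_all add: ip_def ring_distribs sum.distrib mult.assoc flip: sum_distrib_left)
qed

section \<open>Fourier coefficients\<close>

lemma L2_inner_eq_ip: "L2_inner G f g = ip G f g / of_nat (card G)"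
  by (simp add: L2_inner_def ip_def)

lemma mat_add_uminus_eq_0_iff:
  fixes X Y :: "'a::group_add mat"
  assumes X: "X \<in> carrier_mat m n" and Y: "Y \<in> carrier_mat m n"
  shows "X + (- Y) = 0\<^sub>m m n \<longleftrightarrow> X = Y"
proof
  assume e: "X + (- Y) = 0\<^sub>m m n"
  show "X = Y"
  proof (rule eq_matI)
    fix i j assume "i < dim_row Y" "j < dim_col Y"
    then show "X $$ (i, j) = Y $$ (i, j)" using arg_cong[OF e, of "\<lambda>A. A $$ (i, j)"] X Y by simp
  qed (use X Y in auto)
qed (use Y in \<open>auto intro!: eq_matI\<close>)

lemma ip_fourier_char:
  fixes X Y :: "'a::finite_field mat"
  assumes X: "X \<in> carrier_mat n n" and Y: "Y \<in> carrier_mat n n"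
  shows "ip (carrier_mat n n) (fourier_char n X) (fourier_char n Y) =
    (if X = Y then of_nat (CARD('a) ^ (n * n)) else 0)"
proof -
  have "ip (carrier_mat n n) (fourier_char n X) (fourier_char n Y) =
    (\<Sum>A\<in>carrier_mat n n. add_char (mat_trace (A * (X + (- Y)))))"
    unfolding ip_def
  proof (rule sum.cong[OF refl])
    fix A :: "'a mat" assume A: "A \<in> carrier_mat n n"
    have Y': "- Y \<in> carrier_mat n n" using Y by simp
    have "mat_trace (A * (X + (- Y))) = mat_trace (A * X) + mat_trace (A * (- Y))"
      using A X Y' by (simp add: mult_add_distrib_mat[of _ n n] mat_trace_add[of _ n])
    also have "A * (- Y) = - (A * Y)"
      using A Y by simp
    also have "mat_trace (- (A * Y)) = - mat_trace (A * Y)"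
      using A Y by (intro mat_trace_uminus[of _ n]) simp
    finally show "fourier_char n X A * cnj (fourier_char n Y A) = add_char (mat_trace (A * (X + (- Y))))"
      using A by (simp add: fourier_char_def add_char_diff
        mat_trace_comm[OF X A] mat_trace_comm[OF Y A])
  qed
  also have "\<dots> = (if X + (- Y) = 0\<^sub>m n n then of_nat (CARD('a) ^ (n * n)) else 0)"
    using X Y by (intro sum_add_char_mat_trace) simp
  also have "X + (- Y) = 0\<^sub>m n n \<longleftrightarrow> X = Y"
    by (rule mat_add_uminus_eq_0_iff[OF X Y])
  finally show ?thesis .
qed

lemma L2_norm_degree_le_part:
  fixes f :: "'a::finite_field mat \<Rightarrow> complex"
  shows "(L2_norm (carrier_mat n n) (degree_le_part n d f))\<^sup>2 =
    (\<Sum>X\<in>{X \<in> carrier_mat n n. vec_space.rank n X \<le> d}. (cmod (fourier_coeff n f X))\<^sup>2)"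
proof -
  let ?S = "{X \<in> carrier_mat n n. vec_space.rank n X \<le> d} :: 'a mat set"
  let ?c = "fourier_coeff n f"
  let ?N = "of_nat (CARD('a) ^ (n * n)) :: complex"
  have fin: "finite ?S" by (rule finite_subset[OF _ finite_carrier_mat[of n n]]) auto
  have N: "?N \<noteq> 0" by simp
  have "ip (carrier_mat n n) (degree_le_part n d f) (degree_le_part n d f) =
    (\<Sum>X\<in>?S. \<Sum>Y\<in>?S. ?c X * (cnj (?c Y) * ip (carrier_mat n n) (fourier_char n X) (fourier_char n Y)))"
    unfolding degree_le_part_def ip_sum_left ip_scale_left ip_sum_right ip_scale_right sum_distrib_left ..
  also have "\<dots> = (\<Sum>X\<in>?S. \<Sum>Y\<in>?S. if X = Y then ?N * (?c X * cnj (?c X)) else 0)"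
    by (intro sum.cong refl) (auto simp: ip_fourier_char)
  also have "\<dots> = ?N * (\<Sum>X\<in>?S. ?c X * cnj (?c X))"
    using fin by (simp add: sum_distrib_left)
  also have "\<dots> = ?N * of_real (\<Sum>X\<in>?S. (cmod (?c X))\<^sup>2)"
    by (simp only: of_real_sum complex_norm_square)
  finally have "L2_inner (carrier_mat n n) (degree_le_part n d f) (degree_le_part n d f) =
    of_real (\<Sum>X\<in>?S. (cmod (?c X))\<^sup>2)"
    unfolding L2_inner_eq_ip card_carrier_mat using N by simp
  then show ?thesis unfolding L2_norm_def by (simp add: sum_nonneg)
qed

text \<open>By cyclicity of the trace the character at \<open>B * Y\<close> sees \<open>g\<close>
  only through \<open>g * B\<close>, which ties Fourier coefficients to fibres.\<close>

lemma fourier_coeff_ext_zero_mult: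
  fixes B :: "'a::finite_field mat"
  assumes B: "B \<in> carrier_mat n e" and Y: "Y \<in> carrier_mat e n"
  shows "fourier_coeff n (ext_zero n f) (B * Y) =
    (\<Sum>g\<in>SL n. f g * cnj (add_char (mat_trace (Y * (g * B))))) / of_nat (CARD('a) ^ (n * n))"
proof -
  have "(\<Sum>A\<in>carrier_mat n n. ext_zero n f A * cnj (fourier_char n (B * Y) A)) =
    (\<Sum>A\<in>SL n. ext_zero n f A * cnj (fourier_char n (B * Y) A))"
    by (rule sum.mono_neutral_right) (auto simp: ext_zero_def SL_def)
  also have "\<dots> = (\<Sum>g\<in>SL n. f g * cnj (add_char (mat_trace (Y * (g * B)))))"
  proof (rule sum.cong[OF refl])
    fix g :: "'a mat" assume g: "g \<in> SL n"
    note gc = SL_carrier[OF g]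
    have "mat_trace (B * Y * g) = mat_trace (B * (Y * g))"
      using B Y gc by (simp add: assoc_mult_mat[of _ n e _ n _ n])
    also have "\<dots> = mat_trace (Y * g * B)" using B Y gc by (intro mat_trace_comm) auto
    also have "Y * g * B = Y * (g * B)" using B Y gc by (intro assoc_mult_mat[of _ e n _ n _ e]) auto
    finally show "ext_zero n f g * cnj (fourier_char n (B * Y) g) =
        f g * cnj (add_char (mat_trace (Y * (g * B))))"
      using g gc by (simp add: ext_zero_def fourier_char_def)
  qed
  finally show ?thesis
    by (simp add: fourier_coeff_def L2_inner_def card_carrier_mat)
qed

text \<open>After expanding the square and summing over \<open>Y\<close> first, character
  orthogonality keeps the pairs with \<open>y * B = g * B\<close>. The sum includes the
  \<open>Y\<close> of smaller rank, because orthogonality needs all of them.\<close>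

lemma sum_fourier_coeff_mult:
  fixes B :: "'a::finite_field mat"
  assumes B: "B \<in> carrier_mat n d"
  shows "complex_of_real (\<Sum>Y\<in>carrier_mat d n. (cmod (fourier_coeff n (ext_zero n f) (B * Y)))\<^sup>2) =
    of_nat (CARD('a) ^ (d * n)) / (of_nat (CARD('a) ^ (n * n)))\<^sup>2 *
    ip (SL n) (\<lambda>g. \<Sum>y\<in>{y \<in> SL n. y * B = g * B}. f y) f"
proof -
  let ?N = "of_nat (CARD('a) ^ (n * n)) :: complex"
  let ?c = "\<lambda>Y. fourier_coeff n (ext_zero n f) (B * Y)"
  let ?\<chi> = "\<lambda>Y g. add_char (mat_trace (Y * (g * B)))"
  have char: "(\<Sum>Y\<in>carrier_mat d n. ?\<chi> Y g * cnj (?\<chi> Y y)) =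
      (if y * B = g * B then of_nat (CARD('a) ^ (d * n)) else 0)"
    if g: "g \<in> SL n" and y: "y \<in> SL n" for g y
  proof -
    have gB: "g * B \<in> carrier_mat n d" and yB: "y * B \<in> carrier_mat n d"
      using SL_carrier[OF g] SL_carrier[OF y] B by auto
    have "(\<Sum>Y\<in>carrier_mat d n. ?\<chi> Y g * cnj (?\<chi> Y y)) =
      (\<Sum>Y\<in>carrier_mat d n. add_char (mat_trace (Y * (g * B + (- (y * B))))))"
    proof (rule sum.cong[OF refl])
      fix Y :: "'a mat" assume Y: "Y \<in> carrier_mat d n"
      have yB': "- (y * B) \<in> carrier_mat n d" using yB by simp
      have "mat_trace (Y * (g * B + (- (y * B)))) = mat_trace (Y * (g * B)) + mat_trace (Y * (- (y * B)))"
        using Y gB yB' by (simp add: mult_add_distrib_mat[of _ d n] mat_trace_add[of _ d])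
      also have "Y * (- (y * B)) = - (Y * (y * B))"
        by (rule uminus_mult_right_mat) (use Y yB in \<open>metis carrier_matD\<close>)
      also have "mat_trace (- (Y * (y * B))) = - mat_trace (Y * (y * B))"
        using Y yB by (intro mat_trace_uminus[of _ d]) simp
      finally show "?\<chi> Y g * cnj (?\<chi> Y y) = add_char (mat_trace (Y * (g * B + (- (y * B)))))"
        by (simp add: add_char_diff)
    qed
    also have "\<dots> = (if g * B + (- (y * B)) = 0\<^sub>m n d then of_nat (CARD('a) ^ (d * n)) else 0)"
      using gB yB by (intro sum_add_char_mat_trace) simp
    also have "g * B + (- (y * B)) = 0\<^sub>m n d \<longleftrightarrow> y * B = g * B"
      using mat_add_uminus_eq_0_iff[OF gB yB] by metis
    finally show ?thesis .
  qed
  have "complex_of_real (\<Sum>Y\<in>carrier_mat d n. (cmod (?c Y))\<^sup>2) = (\<Sum>Y\<in>carrier_mat d n. ?c Y * cnj (?c Y))"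
    by (simp only: of_real_sum complex_norm_square)
  also have "\<dots> = (\<Sum>Y\<in>carrier_mat d n. (\<Sum>y\<in>SL n. \<Sum>g\<in>SL n. f y * cnj (f g) * (?\<chi> Y g * cnj (?\<chi> Y y)))) / ?N\<^sup>2"
    unfolding sum_divide_distrib
  proof (rule sum.cong[OF refl])
    fix Y :: "'a mat" assume Y: "Y \<in> carrier_mat d n"
    have "?c Y * cnj (?c Y) = (\<Sum>y\<in>SL n. f y * cnj (?\<chi> Y y)) * cnj (\<Sum>g\<in>SL n. f g * cnj (?\<chi> Y g)) / ?N\<^sup>2"
      unfolding fourier_coeff_ext_zero_mult[OF B Y] by (simp add: power2_eq_square)
    also have "\<dots> = (\<Sum>y\<in>SL n. \<Sum>g\<in>SL n. f y * cnj (f g) * (?\<chi> Y g * cnj (?\<chi> Y y))) / ?N\<^sup>2"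
      by (simp add: sum_product mult_ac)
    finally show "?c Y * cnj (?c Y) = (\<Sum>y\<in>SL n. (\<Sum>g\<in>SL n. f y * cnj (f g) * (?\<chi> Y g * cnj (?\<chi> Y y)) / ?N\<^sup>2))"
      by (simp add: sum_divide_distrib)
  qed
  also have "(\<Sum>Y\<in>carrier_mat d n. (\<Sum>y\<in>SL n. \<Sum>g\<in>SL n. f y * cnj (f g) * (?\<chi> Y g * cnj (?\<chi> Y y)))) =
    (\<Sum>y\<in>SL n. \<Sum>g\<in>SL n. f y * cnj (f g) * (\<Sum>Y\<in>carrier_mat d n. ?\<chi> Y g * cnj (?\<chi> Y y)))"
    unfolding sum_distrib_left by (subst sum.swap, rule sum.cong[OF refl], rule sum.swap)
  also have "\<dots> = (\<Sum>y\<in>SL n. \<Sum>g\<in>SL n. if y * B = g * B then of_nat (CARD('a) ^ (d * n)) * (f y * cnj (f g)) else 0)"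
    by (intro sum.cong refl) (simp add: char)
  also have "\<dots> = (\<Sum>g\<in>SL n. \<Sum>y\<in>SL n. if y * B = g * B then of_nat (CARD('a) ^ (d * n)) * (f y * cnj (f g)) else 0)"
    by (rule sum.swap)
  also have "\<dots> = (\<Sum>g\<in>SL n. \<Sum>y\<in>{y \<in> SL n. y * B = g * B}. of_nat (CARD('a) ^ (d * n)) * (f y * cnj (f g)))"
    by (intro sum.cong refl sum.inter_filter[symmetric]) simp
  also have "\<dots> = of_nat (CARD('a) ^ (d * n)) * ip (SL n) (\<lambda>g. \<Sum>y\<in>{y \<in> SL n. y * B = g * B}. f y) f"
    unfolding ip_def by (simp add: sum_distrib_left sum_distrib_right)
  finally show ?thesis by simp
qed

text \<open>The character is constant on each fibre of \<open>g -> g * B\<close>, and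
  \<open>f\<close> sums to 0 there.\<close>

lemma level_fourier_coeff_eq_0:
  fixes B :: "'a::finite_field mat"
  assumes f: "f \<in> L2_SL_level n d" and "0 < d"
    and B: "B \<in> carrier_mat n (d - 1)" and W: "W \<in> carrier_mat (d - 1) n"
  shows "fourier_coeff n (ext_zero n f) (B * W) = 0"
proof -
  let ?\<chi> = "\<lambda>T. cnj (add_char (mat_trace (W * T)))"
  have "(\<Sum>g\<in>SL n. f g * ?\<chi> (g * B)) = (\<Sum>T\<in>carrier_mat n (d - 1). \<Sum>g\<in>{g \<in> SL n. g * B = T}. f g * ?\<chi> (g * B))"
    by (rule sum.group[symmetric]) (use mult_carrier_mat[OF SL_carrier B] in auto)
  also have "\<dots> = (\<Sum>T\<in>carrier_mat n (d - 1). (\<Sum>g\<in>{g \<in> SL n. g * B = T}. f g) * ?\<chi> T)"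
    unfolding sum_distrib_right by (intro sum.cong refl) auto
  also have "\<dots> = 0" using level_fibre_sum_eq_0[OF f \<open>0 < d\<close> B] by simp
  finally show ?thesis unfolding fourier_coeff_ext_zero_mult[OF B W] by simp
qed

text \<open>Rank factorisations of one matrix differ by an invertible \<open>M\<close>: given
  \<open>(B0, Y0)\<close>, any other \<open>B\<close> is \<open>B0 * M\<close> with
  \<open>M = Y0 * Z\<close>, and left invertibility of \<open>B\<close> then determines
  \<open>Y\<close>.\<close>

lemma card_factorizations_le:
  fixes X :: "'a::finite_field mat"
  shows "card {(B, Y). B \<in> left_invertible n d \<and> Y \<in> carrier_mat d n \<and>
    (\<exists>Z\<in>carrier_mat n d. Y * Z = 1\<^sub>m d) \<and> B * Y = X} \<le> card (GL d :: 'a mat set)" (is "card ?F \<le> _")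
proof (cases "?F = {}")
  case True
  show ?thesis unfolding True by simp
next
  case False
  then obtain B0 Y0 where B0: "B0 \<in> left_invertible n d" and Y0: "Y0 \<in> carrier_mat d n" "B0 * Y0 = X"
    by blast
  have B0c: "B0 \<in> carrier_mat n d" using B0 by (simp add: left_invertible_def)
  define \<phi> where "\<phi> M = (B0 * M, THE Y. Y \<in> carrier_mat d n \<and> (B0 * M) * Y = X)" for M
  have "?F \<subseteq> \<phi> ` GL d"
  proof clarify
    fix B Y Z assume B: "B \<in> left_invertible n d" and Y: "Y \<in> carrier_mat d n"
      and Z: "Z \<in> carrier_mat n d" "Y * Z = 1\<^sub>m d" and X: "X = B * Y"
    obtain L where L: "B \<in> carrier_mat n d" "L \<in> carrier_mat d n" "L * B = 1\<^sub>m d"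
      using B by (auto simp: left_invertible_def)
    define M where "M = Y0 * Z"
    have M: "M \<in> carrier_mat d d" using Y0 Z by (simp add: M_def)
    have "B = B * (Y * Z)" using L Z by simp
    also have "\<dots> = (B * Y) * Z" using L Y Z by (intro assoc_mult_mat[symmetric])
    also have "\<dots> = (B0 * Y0) * Z" using X Y0 by simp
    also have "\<dots> = B0 * M" unfolding M_def using B0c Y0 Z by (intro assoc_mult_mat)
    finally have BM: "B = B0 * M" .
    have "(L * B0) * M = L * (B0 * M)" using L B0c M by (intro assoc_mult_mat)
    then have LM: "(L * B0) * M = 1\<^sub>m d" using L BM by simp
    have LB: "L * B0 \<in> carrier_mat d d" using L B0c by simp
    have "M \<in> GL d"
      unfolding GL_def using M LB LM mat_mult_left_right_inverse[OF LB M LM] by blast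
    moreover have "(THE Y'. Y' \<in> carrier_mat d n \<and> (B0 * M) * Y' = X) = Y"
      unfolding BM[symmetric] X using Y left_invertible_cancel[OF B _ Y] by (intro the_equality) auto
    ultimately show "(B, Y) \<in> \<phi> ` GL d"
      by (intro image_eqI[of _ _ M]) (simp_all add: \<phi>_def BM)
  qed
  then have "card ?F \<le> card (\<phi> ` GL d)" by (intro card_mono finite_imageI finite_GL)
  also have "\<dots> \<le> card (GL d :: 'a mat set)" by (intro card_image_le finite_GL)
  finally show ?thesis .
qed

text \<open>Pairs whose \<open>Y\<close> has no right inverse contribute 0 for a function of level
  \<open>d\<close>, and every \<open>X\<close> arises from at most \<open>card (GL d)\<close> of the
  others. That factor is the multiplicity \<open>c\<close> of \<open>fibre_sums\<close>, so it
  cancels in the end.\<close>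

lemma sum_fourier_coeff_factorizations_le:
  fixes f :: "'a::finite_field mat \<Rightarrow> complex"
  assumes f: "f \<in> L2_SL_level n d"
  shows "(\<Sum>B\<in>left_invertible n d. \<Sum>Y\<in>carrier_mat d n. (cmod (fourier_coeff n (ext_zero n f) (B * Y)))\<^sup>2)
    \<le> real (card (GL d :: 'a mat set)) * (\<Sum>X\<in>{X \<in> carrier_mat n n. vec_space.rank n X \<le> d}.
      (cmod (fourier_coeff n (ext_zero n f) X))\<^sup>2)"
proof -
  let ?S = "{X \<in> carrier_mat n n. vec_space.rank n X \<le> d} :: 'a mat set"
  let ?a = "\<lambda>X. (cmod (fourier_coeff n (ext_zero n f) X))\<^sup>2"
  define D :: "('a mat \<times> 'a mat) set" where "D = {(B, Y). B \<in> left_invertible n d \<and> Y \<in> carrier_mat d n \<and>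
    (\<exists>Z\<in>carrier_mat n d. Y * Z = 1\<^sub>m d)}"
  have fS: "finite ?S" by (rule finite_subset[OF _ finite_carrier_mat[of n n]]) auto
  have Ds: "D \<subseteq> left_invertible n d \<times> carrier_mat d n" by (auto simp: D_def)
  have fin: "finite (left_invertible n d \<times> (carrier_mat d n :: 'a mat set))"
    by (simp add: finite_left_invertible)
  have fD: "finite D" by (rule finite_subset[OF Ds fin])
  have "(\<Sum>B\<in>left_invertible n d. \<Sum>Y\<in>carrier_mat d n. ?a (B * Y)) =
    (\<Sum>(B, Y)\<in>left_invertible n d \<times> carrier_mat d n. ?a (B * Y))"
    by (rule sum.cartesian_product)
  also have "\<dots> = (\<Sum>(B, Y)\<in>D. ?a (B * Y))"
  proof (rule sum.mono_neutral_right[OF fin Ds], clarify)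
    fix B Y :: "'a mat"
    assume BY: "B \<in> left_invertible n d" "Y \<in> carrier_mat d n" "(B, Y) \<notin> D"
    have Bc: "B \<in> carrier_mat n d" using BY by (simp add: left_invertible_def)
    obtain C W where d: "0 < d" and CW: "C \<in> carrier_mat d (d - 1)" "W \<in> carrier_mat (d - 1) n" "Y = C * W"
      using right_invertible_or_factor[OF BY(2)] BY by (auto simp: D_def)
    have "B * Y = (B * C) * W" unfolding CW(3) using Bc CW by (intro assoc_mult_mat[symmetric])
    then show "?a (B * Y) = 0"
      using level_fourier_coeff_eq_0[OF f d _ CW(2), of "B * C"] Bc CW by simp
  qed
  also have "\<dots> = (\<Sum>X\<in>?S. \<Sum>(B, Y)\<in>{p \<in> D. (case p of (B, Y) \<Rightarrow> B * Y) = X}. ?a (B * Y))"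
  proof (rule sum.group[symmetric, OF fD fS], clarify)
    fix B Y :: "'a mat" assume "(B, Y) \<in> D"
    then have "B \<in> carrier_mat n d" "Y \<in> carrier_mat d n" by (auto simp: D_def left_invertible_def)
    then show "B * Y \<in> carrier_mat n n \<and> vec_space.rank n (B * Y) \<le> d"
      using rank_mult_le by auto
  qed
  also have "\<dots> = (\<Sum>X\<in>?S. real (card {p \<in> D. (case p of (B, Y) \<Rightarrow> B * Y) = X}) * ?a X)"
    by (rule sum.cong[OF refl], subst sum.cong[OF refl, of _ _ "\<lambda>_. ?a _"]) auto
  also have "\<dots> \<le> (\<Sum>X\<in>?S. real (card (GL d :: 'a mat set)) * ?a X)"
  proof (intro sum_mono mult_right_mono)
    fix X :: "'a mat"
    have "{p \<in> D. (case p of (B, Y) \<Rightarrow> B * Y) = X} = {(B, Y). B \<in> left_invertible n d \<and> Y \<in> carrier_mat d n \<and>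
      (\<exists>Z\<in>carrier_mat n d. Y * Z = 1\<^sub>m d) \<and> B * Y = X}" by (auto simp: D_def)
    then show "real (card {p \<in> D. (case p of (B, Y) \<Rightarrow> B * Y) = X}) \<le> real (card (GL d :: 'a mat set))"
      using card_factorizations_le[of n d X] by simp
  qed simp
  finally show ?thesis by (simp add: sum_distrib_left)
qed

lemma level_ip_ge:
  fixes f :: "'a::finite_field mat \<Rightarrow> complex"
  assumes f: "f \<in> L2_SL_level n d" and "d \<le> n"
  shows "real (card (GL d :: 'a mat set)) * (real (card (SL n :: 'a mat set)) / real (CARD('a) ^ (n * d))) *
      Re (ip (SL n) f f)
    \<le> (\<Sum>B\<in>left_invertible n d. Re (ip (SL n) (\<lambda>g. \<Sum>y\<in>{y \<in> SL n. y * B = g * B}. f y) f))"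
proof -
  interpret fs: fibre_sums "SL n :: 'a mat set" "left_invertible n d" "\<lambda>B g. g * B"
    "\<lambda>B. card {y \<in> SL n. y * B = B}" "real (card (SL n :: 'a mat set)) / real (CARD('a) ^ (n * d))"
    "real (card (GL d :: 'a mat set))"
    by (rule SL_fibre_sums)
  have "ip (SL n) f k = 0" if k: "\<And>B x. B \<in> left_invertible n d \<Longrightarrow> x \<in> SL n \<Longrightarrow> fs.P B k x = 0" for k
  proof (rule level_orthogonal[OF f \<open>d \<le> n\<close>])
    fix B T :: "'a mat" assume B: "B \<in> left_invertible n d"
    show "(\<Sum>g\<in>{g \<in> SL n. g * B = T}. k g) = 0"
    proof (cases "\<exists>x\<in>SL n. x * B = T")
      case True
      then obtain x where "x \<in> SL n" "T = x * B" by blast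
      then show ?thesis using k[OF B, of x] by (simp add: fs.P_def)
    next
      case False
      then have empty: "{g \<in> SL n. g * B = T} = {}" by blast
      show ?thesis unfolding empty by simp
    qed
  qed
  from fs.ip_K_ge[OF this] show ?thesis
    unfolding fs.ip_K_eq_sum Re_sum fs.P_def[abs_def] .
qed

lemma L2_norm_sq: "(L2_norm G f)\<^sup>2 = Re (ip G f f) / real (card G)"
  unfolding L2_norm_def L2_inner_eq_ip using ip_self_nonneg[of G f] by simp

theorem lemma1p12:
  fixes q n d :: nat
    and f :: "'a::finite_field mat \<Rightarrow> complex"
  assumes "CARD('a) = q"
    and "d \<le> n"
    and "f \<in> L2_SL_level n d"
  shows "L2_norm (carrier_mat n n) (degree_le_part n d (ext_zero n f))
           \<ge> 1 / (4 * real q) * L2_norm (SL n) f"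
proof -
  let ?D = "(L2_norm (carrier_mat n n) (degree_le_part n d (ext_zero n f)))\<^sup>2"
  define c where "c = real (card (GL d :: 'a mat set))"
  define s where "s = real (card (SL n :: 'a mat set))"
  define N where "N = real q ^ (n * n)"
  define r where "r = Re (ip (SL n) f f)"
  have q: "0 < real q" unfolding assms(1)[symmetric] by simp
  have N: "0 < N" using q by (simp add: N_def)
  have s: "0 < s" using card_SL_pos[of n, where ?'a = 'a] by (simp add: s_def)
  have r: "0 \<le> r" unfolding r_def by (rule ip_self_nonneg)
  have "1\<^sub>m d \<in> (GL d :: 'a mat set)" by (auto simp: GL_def)
  then have c: "0 < c" using finite_GL[of d, where ?'a = 'a] by (auto simp: c_def card_gt_0_iff)
  have B: "(\<Sum>Y\<in>carrier_mat d n. (cmod (fourier_coeff n (ext_zero n f) (B * Y)))\<^sup>2) =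
    real q ^ (d * n) / N\<^sup>2 * Re (ip (SL n) (\<lambda>g. \<Sum>y\<in>{y \<in> SL n. y * B = g * B}. f y) f)"
    if "B \<in> left_invertible n d" for B :: "'a mat"
  proof -
    have Bc: "B \<in> carrier_mat n d" using that by (simp add: left_invertible_def)
    have e: "of_nat (CARD('a) ^ (d * n)) / (of_nat (CARD('a) ^ (n * n)))\<^sup>2 = complex_of_real (real q ^ (d * n) / N\<^sup>2)"
      unfolding assms(1) N_def by simp
    show ?thesis
      using arg_cong[OF sum_fourier_coeff_mult[OF Bc, of f], of Re] unfolding e by simp
  qed
  have "c * (s / real q ^ (n * d)) * r \<le>
    (\<Sum>B\<in>left_invertible n d. Re (ip (SL n) (\<lambda>g. \<Sum>y\<in>{y \<in> SL n. y * B = g * B}. f y) f))"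
    using level_ip_ge[OF assms(3,2)] unfolding c_def s_def r_def assms(1) by simp
  then have "real q ^ (d * n) / N\<^sup>2 * (c * (s / real q ^ (n * d)) * r) \<le>
    real q ^ (d * n) / N\<^sup>2 *
      (\<Sum>B\<in>left_invertible n d. Re (ip (SL n) (\<lambda>g. \<Sum>y\<in>{y \<in> SL n. y * B = g * B}. f y) f))"
    by (rule mult_left_mono) simp
  also have "\<dots> \<le> c * ?D"
    using sum_fourier_coeff_factorizations_le[OF assms(3)]
    unfolding L2_norm_degree_le_part c_def sum_distrib_left by (simp add: B)
  \<comment> \<open>The power of \<open>q\<close> from character orthogonality cancels the bound on
    the number of fibres, so \<open>d\<close> disappears.\<close>
  also have "real q ^ (d * n) / N\<^sup>2 * (c * (s / real q ^ (n * d)) * r) = c * (s / N\<^sup>2 * r)"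
    using q by (simp add: mult.commute[of d n])
  finally have "c * (s / N\<^sup>2 * r) \<le> c * ?D" .
  then have D: "s / N\<^sup>2 * r \<le> ?D" using c by (rule mult_left_le_imp_le)
  have "N \<le> 2 * real q * s"
    using card_SL_ge[of n, where ?'a = 'a] unfolding N_def s_def assms(1)
    by (metis of_nat_le_iff of_nat_mult of_nat_numeral of_nat_power)
  \<comment> \<open>The order of \<open>SL n\<close> gives \<open>s / N \<ge> 1 / (2 * q)\<close>,
    twice the constant claimed. It enters squared because \<open>r / s\<close> is the squared norm
    of \<open>f\<close>, so that \<open>s / N\<^sup>2 * r\<close> is \<open>(s / N)\<^sup>2\<close>
    times it.\<close>
  then have "1 / (4 * real q) \<le> s / N" using q s N by (simp add: field_simps)
  then have "(1 / (4 * real q))\<^sup>2 * (r / s) \<le> (s / N)\<^sup>2 * (r / s)"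
    using q r s by (intro mult_right_mono power_mono) auto
  also have "\<dots> = s / N\<^sup>2 * r" using s N by (simp add: power2_eq_square field_simps)
  finally have "(1 / (4 * real q) * L2_norm (SL n) f)\<^sup>2 \<le> ?D"
    using D unfolding power_mult_distrib L2_norm_sq r_def s_def by linarith
  then show ?thesis by (rule power2_le_imp_le) (simp add: L2_norm_def L2_inner_eq_ip ip_self_nonneg)
qed

end
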